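(* Let $0<d<\pi/2$, $\mathscr{D}_d=\{\zeta\in\mathbb{C}:|\Im\zeta|<d\}$, and $\psi(t)=e^{(\pi/2)\sinh t}$. Assume $f$ is analytic on $\psi(\mathscr{D}_d)$ and there are constants $K,\alpha,\beta>0$ with $|f(z)|\le K\left|\frac{z^{\alpha-1}}{(1+z^2)^{(\alpha+\beta)/2}}\right|$ for all $z\in\psi(\mathscr{D}_d)$. Let $\mu=\min\{\alpha,\beta\}$, $\nu=\max\{\alpha,\beta\}$, let $n$ be a positive integer, $h=\log(4dn/\mu)/n$, and let $M=n$, $N=n-\lfloor\log(\beta/\alpha)/h\rfloor$ if $\mu=\alpha$, and $N=n$, $M=n-\lfloor\log(\alpha/\beta)/h\rfloor$ if $\mu=\beta$. Suppose $n\ge\nu e/(4d)$, $Mh\ge x_{\alpha/2}$, $Nh\ge x_{\beta/2}$. Then \[ \sup_{\tau\in(0,\infty)}\left|\int_{0}^{\tau}f(t)\,dt-\sum_{k=-M}^{N}f(\psi(kh))\psi'(kh)J(k,h)(\psi^{-1}(\tau))\right|\le C_2\,\frac{e^{-\pi dn/\log(4dn/\mu)}\log(4dn/\mu)}{n}, \] with $C_2=\frac{2K}{\mu d}\left\{\frac{1}{(1-e^{-\pi\mu e/2})\{\cos(\frac\pi2\sin d)\}^{(\alpha+\beta)/2}\cos d}+e^{\pi(\alpha+\beta)/4}\right\}$.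
   Context: $J(k,h)(x)=h\left\{\frac12+\frac1\pi\operatorname{Si}[\pi(x/h-k)]\right\}$ with $\operatorname{Si}(x)=\int_0^x\frac{\sin\sigma}{\sigma}d\sigma$. For $\gamma>0$, $x_\gamma=\operatorname{arcsinh}\!\left(\frac{\sqrt{1+\sqrt{1-(2\pi\gamma)^2}}}{2\pi\gamma}\right)$ if $0<\gamma<1/(2\pi)$, and $x_\gamma=\operatorname{arcsinh}(1)$ if $\gamma\ge1/(2\pi)$. Complex powers use principal branches. *)

theory Defs
  imports "HOL-Analysis.Analysis" "HOL-Probability.Sinc_Integral"
begin

(* Si is the library's sine integral: Si t = LBINT x=0..t. sin x / x *)

definition Jfun :: "int \<Rightarrow> real \<Rightarrow> real \<Rightarrow> real" where
  "Jfun k h x = h * (1/2 + (1/pi) * Si (pi * (x / h - real_of_int k)))"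

definition xgam :: "real \<Rightarrow> real" where
  "xgam \<gamma> = (if 0 < \<gamma> \<and> \<gamma> < 1 / (2*pi)
     then arsinh (sqrt (1 + sqrt (1 - (2*pi*\<gamma>)^2)) / (2*pi*\<gamma>))
     else arsinh 1)"

definition strip :: "real \<Rightarrow> complex set" where
  "strip d = {\<zeta>. \<bar>Im \<zeta>\<bar> < d}"

definition psiC :: "complex \<Rightarrow> complex" where
  "psiC \<zeta> = exp (complex_of_real (pi/2) * sinh \<zeta>)"

definition psiR :: "real \<Rightarrow> real" where
  "psiR t = exp (pi/2 * sinh t)"

definition psiR' :: "real \<Rightarrow> real" where
  "psiR' t = pi/2 * cosh t * exp (pi/2 * sinh t)"

definition psiR_inv :: "real \<Rightarrow> real" where
  "psiR_inv \<tau> = arsinh (2/pi * ln \<tau>)"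

end

theory Submission
  imports Defs "HOL-Complex_Analysis.Complex_Analysis"
begin

text \<open>
  Put \<open>F \<zeta> = f (\<psi> \<zeta>) \<psi>' \<zeta>\<close>, so that the integral over \<open>(0, \<tau>)\<close> becomes the integral of \<open>F\<close> over
  \<open>(-\<infinity>, x)\<close> with \<open>x = \<psi>\<^sup>-\<^sup>1 \<tau>\<close>.  The error splits into a discretization and a truncation part.

  Discretization: by the residue theorem on a rectangle with horizontal sides at height \<open>\<plusminus>e\<close>,
  \<open>e < d\<close>, the error of sinc interpolation of \<open>F\<close> at \<open>t\<close> is \<open>sin (\<pi> t/h) / (2 \<pi> i)\<close> times the contour
  integral of \<open>F \<zeta> / ((\<zeta> - t) sin (\<pi> \<zeta>/h))\<close>.  Integrating in \<open>t\<close> first, the kernel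
  \<open>\<integral> sin (\<pi> t/h) / (\<zeta> - t) dt\<close> is at most \<open>(1 + \<pi>) h / (\<pi> e)\<close> by one integration by parts, while
  \<open>|sin (\<pi> \<zeta>/h)| \<ge> sinh (\<pi> e/h)\<close>; then let the rectangle grow and \<open>e \<longrightarrow> d\<close>.  The decay of \<open>F\<close> on the
  strip comes from \<open>|1 + exp (\<pi> sinh \<zeta>)| \<ge> (1 + exp (\<pi> sinh u cos y)) cos (\<pi>/2 sin y)\<close> for
  \<open>\<zeta> = u + i y\<close>.

  Truncation: \<open>g u = cosh u exp (- b sinh u)\<close> need not be decreasing beyond the threshold \<open>x\<^sub>\<gamma>\<close>,
  but \<open>g v \<le> \<surd>2 g u\<close> for \<open>v \<ge> u \<ge> x\<^sub>\<gamma>\<close>.  This compares the discarded terms with an integral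
  up to the factor \<open>\<surd>2\<close>, which the constant in the claim absorbs.
\<close>

section \<open>The modulus of \<open>1 + exp (\<pi> sinh \<zeta>)\<close> on a strip\<close>

text \<open>Jordan's inequality: sine is concave on [0, pi/2] and so lies above the chord joining
  its end values 0 and 1.\<close>

lemma sin_ge_chord:
  fixes w :: real
  assumes "0 \<le> w" "w \<le> pi/2"
  shows "2 * w / pi \<le> sin w"
proof -
  have "concave_on {0..pi/2} (sin :: real \<Rightarrow> real)"
    by (rule f''_le0_imp_concave[where f' = cos and f'' = "\<lambda>x. - sin x"])
       (auto intro!: derivative_eq_intros sin_ge_zero)
  from concave_onD_Icc'[OF this, of w] assms show ?thesis
    by (simp add: field_simps)
qed

text \<open>The factor on the right splits as (pi/2 - w)(pi/2 + w). The first part dominates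
  \<open>cos w\<close>, and the second times \<open>sin w\<close> is at least \<open>w\<close> by
  the chord bound.\<close>

lemma mult_cos_le_mult_sin:
  fixes w :: real
  assumes "0 \<le> w" "w \<le> pi/2"
  shows "w * cos w \<le> (pi\<^sup>2/4 - w\<^sup>2) * sin w"
proof -
  have "cos w = sin (pi/2 - w)"
    by (simp add: cos_sin_eq)
  also have "\<dots> \<le> pi/2 - w"
    using assms by (intro sin_x_le_x) simp
  finally have "w * cos w \<le> w * (pi/2 - w)"
    using assms by (simp add: mult_left_mono)
  also have "w \<le> (pi/2 + w) * (2 * w / pi)"
    using assms by (simp add: field_simps)
  then have "w \<le> (pi/2 + w) * sin w"
    using sin_ge_chord[OF assms] assms
    by (meson add_nonneg_nonneg mult_left_mono order_trans pi_half_ge_zero)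
  then have "w * (pi/2 - w) \<le> (pi/2 + w) * sin w * (pi/2 - w)"
    using assms by (intro mult_right_mono) auto
  also have "\<dots> = (pi\<^sup>2/4 - w\<^sup>2) * sin w"
    by (simp add: field_simps power2_eq_square)
  finally show ?thesis .
qed

text \<open>The difference of the two sides vanishes at 0 and has derivative
  \<open>z/3 * (z * cosh z - sinh z)\<close>. A second application of the same argument shows that
  this is nonnegative.\<close>

lemma mult_cosh_le_mult_sinh:
  fixes z :: real
  assumes "0 \<le> z"
  shows "z * cosh z \<le> (1 + z\<^sup>2/3) * sinh z"
proof -
  have 1: "sinh u \<le> u * cosh u" if "0 \<le> u" for u :: real
  proof -
    have "(\<lambda>u. u * cosh u - sinh u) 0 \<le> (\<lambda>u. u * cosh u - sinh u) u"
    proof (rule DERIV_nonneg_imp_nondecreasing[OF that])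
      fix v :: real assume v: "0 \<le> v"
      have "((\<lambda>u. u * cosh u - sinh u) has_real_derivative v * sinh v) (at v)"
        by (auto intro!: derivative_eq_intros)
      with v show "\<exists>y. ((\<lambda>u. u * cosh u - sinh u) has_real_derivative y) (at v) \<and> 0 \<le> y"
        by (intro exI[of _ "v * sinh v"]) simp
    qed
    then show ?thesis by simp
  qed
  have "(\<lambda>z. (1 + z\<^sup>2/3) * sinh z - z * cosh z) 0 \<le> (\<lambda>z. (1 + z\<^sup>2/3) * sinh z - z * cosh z) z"
  proof (rule DERIV_nonneg_imp_nondecreasing[OF assms])
    fix u :: real assume u: "0 \<le> u"
    have "((\<lambda>z. (1 + z\<^sup>2/3) * sinh z - z * cosh z) has_real_derivative u / 3 * (u * cosh u - sinh u)) (at u)"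
      by (auto intro!: derivative_eq_intros simp: algebra_simps power2_eq_square)
    moreover have "0 \<le> u / 3 * (u * cosh u - sinh u)"
      using 1[OF u] u by simp
    ultimately show "\<exists>y. ((\<lambda>z. (1 + z\<^sup>2/3) * sinh z - z * cosh z) has_real_derivative y) (at u) \<and> 0 \<le> y"
      by blast
  qed
  then show ?thesis by simp
qed

text \<open>The quotient of \<open>sin (A * cosh x)\<close> by \<open>cosh (B * sinh x)\<close>
  equals \<open>sin A\<close> at 0, and it is nonincreasing as long as the argument of the sine
  stays in (0, pi/2]. The two preceding inequalities decide the sign of its derivative.\<close>

lemma sin_mult_cosh_le_aux:
  fixes x A B :: real
  assumes A: "0 < A" "A \<le> pi/2" and B: "0 \<le> B" and AB: "A\<^sup>2 + B\<^sup>2 = pi\<^sup>2/4"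
    and x: "0 \<le> x" and w: "A * cosh x \<le> pi/2"
  shows "sin (A * cosh x) \<le> sin A * cosh (B * sinh x)"
proof -
  let ?q = "\<lambda>x. sin (A * cosh x) / cosh (B * sinh x)"
  have "?q x \<le> ?q 0"
  proof (rule DERIV_nonpos_imp_nonincreasing[OF x])
    fix u assume u: "0 \<le> u" "u \<le> x"
    define w z where "w = A * cosh u" and "z = B * sinh u"
    have "cosh u \<le> cosh x" using u by (simp add: cosh_real_nonneg_le_iff)
    then have "w \<le> A * cosh x"
      using A by (simp add: w_def)
    then have w2: "0 < w" "w \<le> pi/2"
      using w A unfolding w_def by (simp, linarith)
    have z0: "0 \<le> z" using u B by (simp add: z_def)
    have sw: "0 \<le> sin w" using w2 by (intro sin_ge_zero) auto
    have ws: "w\<^sup>2 = A\<^sup>2 + A\<^sup>2 * (sinh u)\<^sup>2"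
      by (simp add: w_def power_mult_distrib cosh_square_eq algebra_simps)
    have "0 \<le> A\<^sup>2 * (sinh u)\<^sup>2" by simp
    \<comment> \<open>The constraint on \<open>A\<close> and \<open>B\<close> enters here: w is at
      least A, so pi^2/4 - w^2 is at most pi^2/4 - A^2 = B^2.\<close>
    then have "pi\<^sup>2/4 - w\<^sup>2 \<le> B\<^sup>2" using AB ws by linarith
    then have "w * cos w \<le> B\<^sup>2 * sin w"
      using mult_cos_le_mult_sin[of w] w2 sw by (meson less_imp_le mult_right_mono order_trans)
    then have "w * cos w * (sinh u * cosh z) \<le> B\<^sup>2 * sin w * (sinh u * cosh z)"
      using u by (intro mult_right_mono) auto
    also have "\<dots> = B * sin w * (z * cosh z)"
      by (simp add: z_def power2_eq_square)
    also have "\<dots> \<le> B * sin w * ((1 + z\<^sup>2/3) * sinh z)"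
      using mult_cosh_le_mult_sinh[OF z0] B sw by (intro mult_left_mono) auto
    also have "\<dots> \<le> B * sin w * ((cosh u)\<^sup>2 * sinh z)"
    proof -
      \<comment> \<open>B^2 is at most pi^2/4 < 3, which beats the 3 in the denominator and turns 1
        + z^2/3 into at most 1 + (sinh u)^2.\<close>
      have "B\<^sup>2 \<le> pi\<^sup>2 / 4" using AB by (metis le_add_same_cancel2 zero_le_power2)
      also have "pi\<^sup>2 \<le> 3.2^2"
        using pi_less_4 pi_approx by (intro power_mono) auto
      finally have "B\<^sup>2 \<le> 3" by (simp add: power2_eq_square)
      then have "B\<^sup>2 * (sinh u)\<^sup>2 \<le> 3 * (sinh u)\<^sup>2" by (intro mult_right_mono) auto
      then have "1 + z\<^sup>2/3 \<le> (cosh u)\<^sup>2"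
        by (simp add: z_def power_mult_distrib cosh_square_eq)
      then show ?thesis using B sw z0 by (intro mult_left_mono mult_right_mono) auto
    qed
    finally have "cosh u * (A * sinh u * cos w * cosh z) \<le> cosh u * (B * cosh u * sin w * sinh z)"
      by (simp add: w_def power2_eq_square mult_ac)
    then have le: "A * sinh u * cos w * cosh z \<le> B * cosh u * sin w * sinh z"
      by (rule mult_left_le_imp_le) simp
    have "(?q has_real_derivative (cos w * (A * sinh u) * cosh z - sin w * (sinh z * (B * cosh u))) / (cosh z * cosh z)) (at u)"
      unfolding w_def z_def by (auto intro!: derivative_eq_intros)
    moreover have "(cos w * (A * sinh u) * cosh z - sin w * (sinh z * (B * cosh u))) / (cosh z * cosh z) \<le> 0"
      using le by (intro divide_nonpos_pos) (auto simp: mult_ac)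
    ultimately show "\<exists>y. (?q has_real_derivative y) (at u) \<and> y \<le> 0" by blast
  qed
  then show ?thesis by (simp add: field_simps)
qed

text \<open>The previous lemma reaches up to the point \<open>x0\<close> where the argument of the
  sine is pi/2. There the right-hand side is at least 1, and it only grows afterwards.\<close>

lemma sin_mult_cosh_le:
  fixes x A B :: real
  assumes A: "0 < A" "A \<le> pi/2" and B: "0 \<le> B" and AB: "A\<^sup>2 + B\<^sup>2 = pi\<^sup>2/4" and x: "0 \<le> x"
  shows "\<bar>sin (A * cosh x)\<bar> \<le> sin A * cosh (B * sinh x)"
proof (cases "A * cosh x \<le> pi/2")
  case True
  have "0 \<le> sin (A * cosh x)" using True A by (intro sin_ge_zero) auto
  then show ?thesis using sin_mult_cosh_le_aux[OF A B AB x True] by simp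
next
  case False
  define x0 where "x0 = arcosh (pi / 2 / A)"
  have c: "cosh x0 = pi / 2 / A" and x0: "0 \<le> x0"
    using A by (auto simp: x0_def field_simps intro: cosh_arcosh_real arcosh_nonneg_real)
  have "A * cosh x0 < A * cosh x" using False A c by simp
  then have "cosh x0 < cosh x" using A by simp
  then have "x0 \<le> x" using x x0 by (metis cosh_real_nonneg_less_iff less_imp_le)
  have "1 = sin (A * cosh x0)" using A c by simp
  also have "\<dots> \<le> sin A * cosh (B * sinh x0)"
    by (rule sin_mult_cosh_le_aux[OF A B AB x0]) (use c A in simp)
  also have "\<dots> \<le> sin A * cosh (B * sinh x)"
    using \<open>x0 \<le> x\<close> x0 B A sin_ge_zero[of A]
    by (intro mult_left_mono) (auto simp: cosh_real_nonneg_le_iff intro!: mult_left_mono)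
  finally show ?thesis by (meson abs_sin_le_one order_trans)
qed

text \<open>Takes \<open>A\<close> = |pi/2 sin y| and \<open>B\<close> = pi/2 cos y, whose squares
  add up to pi^2/4. The arguments containing x are half the imaginary and half the real part of pi
  sinh(x + iy).\<close>

lemma sin_mult_cosh_le':
  fixes x y :: real
  assumes "\<bar>y\<bar> < pi/2"
  shows "\<bar>sin (pi/2 * (cosh x * sin y))\<bar> \<le> \<bar>sin (pi/2 * sin y)\<bar> * cosh (pi/2 * (sinh x * cos y))"
proof (cases "y = 0")
  case False
  define A B where "A = \<bar>pi/2 * sin y\<bar>" and "B = pi/2 * cos y"
  have c: "0 < cos y" using assms by (intro cos_gt_zero_pi) auto
  have "sin y \<noteq> 0"
    using assms False sin_eq_0_pi[of y] by linarith
  then have A0: "0 < A" by (simp add: A_def)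
  have "pi / 2 * \<bar>sin y\<bar> \<le> pi / 2 * 1" by (intro mult_left_mono) auto
  then have A2: "A \<le> pi/2" by (simp add: A_def abs_mult)
  have AB: "A\<^sup>2 + B\<^sup>2 = pi\<^sup>2/4"
    using sin_cos_squared_add[of y]
    by (simp add: A_def B_def power_mult_distrib power_divide flip: distrib_left)
  have "\<bar>sin (A * cosh \<bar>x\<bar>)\<bar> \<le> sin A * cosh (B * sinh \<bar>x\<bar>)"
    using c by (intro sin_mult_cosh_le A0 A2 AB) (auto simp: B_def)
  moreover have "\<bar>sin (A * cosh \<bar>x\<bar>)\<bar> = \<bar>sin (pi/2 * (cosh x * sin y))\<bar>"
    by (cases "0 \<le> sin y") (auto simp: A_def mult_ac abs_mult)
  moreover have "sin A = \<bar>sin (pi/2 * sin y)\<bar>"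
  proof -
    have "0 \<le> sin A" using A0 A2 by (intro sin_ge_zero) auto
    then show ?thesis
      by (cases "0 \<le> sin y") (auto simp: A_def abs_mult)
  qed
  moreover have "cosh (B * sinh \<bar>x\<bar>) = cosh (pi/2 * (sinh x * cos y))"
    by (cases "0 \<le> x") (auto simp: B_def mult_ac)
  ultimately show ?thesis by (simp only:)
qed simp

text \<open>|1 + e^(p+iq)|^2 = (1 + e^p)^2 - 4 e^p sin^2(q/2), and 4 e^p cosh^2(p/2) = (1 + e^p)^2.
  The assumption therefore leaves at least (1 + e^p)^2 (1 - sin^2 \<phi>).\<close>

lemma norm_one_plus_exp_ge:
  fixes p q \<phi> :: real
  assumes "\<bar>sin (q/2)\<bar> \<le> \<bar>sin \<phi>\<bar> * cosh (p/2)"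
  shows "(1 + exp p) * cos \<phi> \<le> norm (1 + exp (Complex p q))"
proof (rule power2_le_imp_le)
  have e: "4 * exp p * (cosh (p/2))\<^sup>2 = (1 + exp p)\<^sup>2"
    by (simp add: cosh_def power2_eq_square field_simps exp_minus flip: exp_add)
  have "(sin (q/2))\<^sup>2 \<le> (\<bar>sin \<phi>\<bar> * cosh (p/2))\<^sup>2"
    using assms by (metis abs_ge_zero power2_abs power_mono)
  then have "4 * exp p * (sin (q/2))\<^sup>2 \<le> 4 * exp p * ((sin \<phi>)\<^sup>2 * (cosh (p/2))\<^sup>2)"
    by (simp add: power_mult_distrib)
  also have "\<dots> = (1 + exp p)\<^sup>2 * (sin \<phi>)\<^sup>2"
    using e by (simp add: mult_ac)
  finally have 1: "4 * exp p * (sin (q/2))\<^sup>2 \<le> (1 + exp p)\<^sup>2 * (sin \<phi>)\<^sup>2" .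
  have "cos q = 1 - 2 * (sin (q/2))\<^sup>2"
    using cos_double_sin[of "q/2"] by simp
  then have "(norm (1 + exp (Complex p q)))\<^sup>2 = (1 + exp p)\<^sup>2 - 4 * exp p * (sin (q/2))\<^sup>2"
    using sin_cos_squared_add[of q]
    by (simp add: cmod_power2 Re_exp Im_exp) algebra
  also have "\<dots> \<ge> (1 + exp p)\<^sup>2 - (1 + exp p)\<^sup>2 * (sin \<phi>)\<^sup>2"
    using 1 by simp
  also have "(1 + exp p)\<^sup>2 - (1 + exp p)\<^sup>2 * (sin \<phi>)\<^sup>2 = ((1 + exp p) * cos \<phi>)\<^sup>2"
    by (simp only: power_mult_distrib cos_squared_eq right_diff_distrib mult_1_right)
  finally show "((1 + exp p) * cos \<phi>)\<^sup>2 \<le> (norm (1 + exp (Complex p q)))\<^sup>2" .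
qed simp

section \<open>Tails of the double exponential weight\<close>

text \<open>With c = 2 pi \<gamma>, the value of c sinh at the threshold is sqrt(1 + sqrt(1 - c^2))
  if c < 1, and c itself otherwise. This lower bound is the form in which the threshold enters the
  tail estimates.\<close>

lemma sinh_ge_of_xgam:
  assumes "0 < \<gamma>" "xgam \<gamma> \<le> x"
  shows "1 \<le> 2 * pi * \<gamma> * sinh x" and "0 < x"
proof -
  define c where "c = 2 * pi * \<gamma>"
  have c0: "0 < c" using assms by (simp add: c_def)
  have "1 \<le> c * sinh (xgam \<gamma>)"
  proof (cases "\<gamma> < 1 / (2 * pi)")
    case True
    then have "c < 1" by (simp add: c_def field_simps)
    then have "c\<^sup>2 \<le> 1" using c0 by (simp add: power_le_one)
    then show ?thesis using True assms c0 by (simp add: xgam_def flip: c_def)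
  next
    case False
    then have "1 \<le> c" by (simp add: c_def field_simps)
    then show ?thesis using False by (simp add: xgam_def)
  qed
  also have "\<dots> \<le> c * sinh x"
    using assms c0 by simp
  finally show 1: "1 \<le> 2 * pi * \<gamma> * sinh x" by (simp add: c_def)
  then have "0 < c * sinh x" unfolding c_def by linarith
  then show "0 < x" using c0 by (simp add: zero_less_mult_iff)
qed

text \<open>With s = sinh x, \<delta> = sinh y - sinh x and c = 2b, the squared claim reads 1 + (s +
  \<delta>)^2 \<le> 2 (1 + s^2) e^(c\<delta>). The assumption cs \<ge> 1 supplies the missing powers
  of c, after which the quadratic Taylor bound applies. Its coefficient 1/2 costs the factor 2,
  hence sqrt 2 after taking roots.\<close>

lemma cosh_exp_sinh_almost_antimono:
  fixes b x y :: real
  assumes b: "0 < b" and x: "1 \<le> 2 * b * sinh x" and xy: "x \<le> y"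
  shows "cosh y * exp (- b * sinh y) \<le> sqrt 2 * (cosh x * exp (- b * sinh x))"
proof (rule power2_le_imp_le)
  define s \<delta> c where "s = sinh x" and "\<delta> = sinh y - sinh x" and "c = 2 * b"
  have \<delta>: "0 \<le> \<delta>" and c: "0 < c" using xy b by (auto simp: \<delta>_def c_def)
  have cs: "1 \<le> c * s" using x by (simp add: c_def s_def)
  then have s: "0 < s" using c by (smt (verit) zero_less_mult_iff mult_nonneg_nonpos)
  have "1 + (s + \<delta>)\<^sup>2 = (1 + s\<^sup>2) + 2 * s * \<delta> + \<delta>\<^sup>2"
    by (simp add: power2_eq_square algebra_simps)
  also have "\<dots> \<le> (1 + s\<^sup>2) + 2 * s * \<delta> * (c * s) + \<delta>\<^sup>2 * (c * s)\<^sup>2"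
  proof -
    have "2 * s * \<delta> * 1 \<le> 2 * s * \<delta> * (c * s)" using cs s \<delta> by (intro mult_left_mono) auto
    moreover have "\<delta>\<^sup>2 * 1 \<le> \<delta>\<^sup>2 * (c * s)\<^sup>2" using cs by (intro mult_left_mono) (auto simp: one_le_power)
    ultimately show ?thesis by simp
  qed
  also have "\<dots> \<le> (1 + s\<^sup>2) * (2 * (1 + c * \<delta> + (c * \<delta>)\<^sup>2 / 2))"
    using c s \<delta> by (simp add: power2_eq_square algebra_simps)
  also have "\<dots> \<le> (1 + s\<^sup>2) * (2 * exp (c * \<delta>))"
    using exp_lower_Taylor_quadratic[of "c * \<delta>"] c \<delta> by (intro mult_left_mono) auto
  finally have "1 + (s + \<delta>)\<^sup>2 \<le> (1 + s\<^sup>2) * (2 * exp (c * \<delta>))" .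
  then have "(cosh y)\<^sup>2 \<le> 2 * (cosh x)\<^sup>2 * exp (c * \<delta>)"
    by (simp add: s_def \<delta>_def cosh_square_eq algebra_simps)
  then have "(cosh y)\<^sup>2 * exp (- c * sinh y) \<le> 2 * (cosh x)\<^sup>2 * exp (c * \<delta>) * exp (- c * sinh y)"
    by (intro mult_right_mono) auto
  also have "\<dots> = 2 * (cosh x)\<^sup>2 * exp (- c * sinh x)"
    by (simp add: \<delta>_def algebra_simps flip: exp_add)
  finally show "(cosh y * exp (- b * sinh y))\<^sup>2 \<le> (sqrt 2 * (cosh x * exp (- b * sinh x)))\<^sup>2"
    by (simp add: power_mult_distrib c_def mult_ac flip: exp_double)
qed simp

text \<open>By the mean value theorem the primitive of the weight changes over [kh, (k+1)h] by h
  times the weight at an inner point; the weight at the right end is at most sqrt 2 times as large.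
  The differences of \<open>P\<close> then telescope.\<close>

lemma sum_cosh_exp_sinh_le:
  fixes b h :: real and N :: int
  assumes b: "0 < b" and h: "0 < h" and N: "1 \<le> 2 * b * sinh (N * h)"
  shows "(\<Sum>k\<in>{N<..N + int m}. h * (cosh (k * h) * exp (- b * sinh (k * h))))
           \<le> sqrt 2 / b * exp (- b * sinh (N * h))"
proof -
  define P :: "int \<Rightarrow> real" where "P k = sqrt 2 / b * exp (- b * sinh (k * h))" for k
  have step: "h * (cosh ((k + 1) * h) * exp (- b * sinh ((k + 1) * h))) \<le> P k - P (k + 1)"
    if "N \<le> k" for k :: int
  proof -
    have lt: "real_of_int k * h < (k + 1) * h" using h by simp
    have "((\<lambda>x. - exp (- b * sinh x) / b) has_real_derivative cosh x * exp (- b * sinh x)) (at x)" for x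
      using b by (auto intro!: derivative_eq_intros)
    from MVT2[OF lt this] obtain z where z: "k * h < z" "z < (k + 1) * h"
      and eq: "- exp (- b * sinh ((k + 1) * h)) / b - (- exp (- b * sinh (k * h)) / b)
                 = ((k + 1) * h - k * h) * (cosh z * exp (- b * sinh z))"
      by blast
    have "N * h \<le> k * h" using that h by simp
    then have "N * h \<le> z" using z by linarith
    then have "2 * b * sinh (N * h) \<le> 2 * b * sinh z" using b by simp
    with N have "1 \<le> 2 * b * sinh z" by linarith
    from cosh_exp_sinh_almost_antimono[OF b this, of "(k + 1) * h"] z
    have "h * (cosh ((k + 1) * h) * exp (- b * sinh ((k + 1) * h)))
            \<le> h * (sqrt 2 * (cosh z * exp (- b * sinh z)))"
      using h by (intro mult_left_mono) auto
    also have "\<dots> = sqrt 2 * (((k + 1) * h - k * h) * (cosh z * exp (- b * sinh z)))"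
      by (simp add: algebra_simps)
    also have "\<dots> = P k - P (k + 1)"
      unfolding eq[symmetric] by (simp add: P_def algebra_simps)
    finally show ?thesis by simp
  qed
  have "(\<Sum>k\<in>{N<..N + int m}. h * (cosh (k * h) * exp (- b * sinh (k * h)))) \<le> P N - P (N + int m)"
  proof (induction m)
    case (Suc m)
    have "{N<..N + int (Suc m)} = insert (N + int m + 1) {N<..N + int m}" by auto
    then show ?case using Suc step[of "N + int m"] by (simp add: add_ac)
  qed simp
  also have "\<dots> \<le> P N" using b by (simp add: P_def)
  finally show ?thesis by (simp add: P_def)
qed

section \<open>The basis functions of indefinite sinc integration\<close>

lemma Si_minus: "Si (- x) = - Si x"
  using Si_neg[of x] Si_neg[of "- x"] by (cases "0 \<le> x") auto

text \<open>On [0, 1] the integrand is at most 1 in modulus. Beyond 1,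
  \<open>Si x - (1 - cos x) / x\<close> increases and \<open>Si x + (1 + cos x) / x\<close>
  decreases, both towards pi/2, and the correction terms are at most 2. Negative arguments follow by
  oddness.\<close>

lemma abs_Si_le: "\<bar>Si x\<bar> \<le> pi / 2 + 2"
proof -
  have main: "\<bar>Si x\<bar> \<le> pi / 2 + 2" if "0 \<le> x" for x
  proof (cases "x \<le> 1")
    case True
    have "x - Si x \<ge> 0 - Si 0"
    proof (rule DERIV_nonneg_imp_nondecreasing[OF that])
      fix u :: real
      have "((\<lambda>x. x - Si x) has_real_derivative 1 - sinc u) (at u)"
        by (auto intro!: derivative_eq_intros DERIV_Si)
      moreover have "sinc u \<le> 1"
        using abs_sin_x_le_abs_x[of u] by (auto simp: divide_le_eq abs_if split: if_splits)
      ultimately show "\<exists>y. ((\<lambda>x. x - Si x) has_real_derivative y) (at u) \<and> 0 \<le> y"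
        by (intro exI[of _ "1 - sinc u"]) auto
    qed
    moreover have "x + Si x \<ge> 0 + Si 0"
    proof (rule DERIV_nonneg_imp_nondecreasing[OF that])
      fix u :: real
      have "((\<lambda>x. x + Si x) has_real_derivative 1 + sinc u) (at u)"
        by (auto intro!: derivative_eq_intros DERIV_Si)
      moreover have "- 1 \<le> sinc u"
        using abs_sin_x_le_abs_x[of u] by (auto simp: le_divide_eq abs_if split: if_splits)
      ultimately show "\<exists>y. ((\<lambda>x. x + Si x) has_real_derivative y) (at u) \<and> 0 \<le> y"
        by (intro exI[of _ "1 + sinc u"]) auto
    qed
    moreover have "Si 0 = 0" using Si_neg[of 0] by simp
    ultimately show ?thesis using True pi_gt_zero unfolding abs_le_iff by linarith
  next
    case False
    have 1: "Si x - (1 - cos x) / x \<le> Si y - (1 - cos y) / y" if "x \<le> y" for y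
    proof (rule DERIV_nonneg_imp_nondecreasing[OF that])
      fix u :: real assume "x \<le> u"
      with False have u: "u > 0" by simp
      have "((\<lambda>x. Si x - (1 - cos x) / x) has_real_derivative (1 - cos u) / u\<^sup>2) (at u)"
        using u by (auto intro!: derivative_eq_intros DERIV_Si simp: field_simps power2_eq_square)
      moreover have "0 \<le> (1 - cos u) / u\<^sup>2" by simp
      ultimately show "\<exists>y. ((\<lambda>x. Si x - (1 - cos x) / x) has_real_derivative y) (at u) \<and> 0 \<le> y"
        by blast
    qed
    have 2: "Si x + (1 + cos x) / x \<ge> Si y + (1 + cos y) / y" if "x \<le> y" for y
    proof (rule DERIV_nonpos_imp_nonincreasing[OF that])
      fix u :: real assume "x \<le> u"
      with False have u: "u > 0" by simp
      have "((\<lambda>x. Si x + (1 + cos x) / x) has_real_derivative - ((1 + cos u) / u\<^sup>2)) (at u)"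
        using u by (auto intro!: derivative_eq_intros DERIV_Si simp: field_simps power2_eq_square)
      moreover have "0 \<le> (1 + cos u) / u\<^sup>2"
        using cos_ge_minus_one[of u] by (intro divide_nonneg_nonneg zero_le_power2) linarith
      then have "- ((1 + cos u) / u\<^sup>2) \<le> 0" by linarith
      ultimately show "\<exists>y. ((\<lambda>x. Si x + (1 + cos x) / x) has_real_derivative y) (at u) \<and> y \<le> 0"
        by blast
    qed
    have ev: "\<forall>\<^sub>F y in at_top. x \<le> y" by (rule eventually_ge_at_top)
    have le: "Si x - (1 - cos x) / x \<le> pi / 2"
    proof (rule tendsto_lowerbound[OF Si_at_top])
      show "\<forall>\<^sub>F y in at_top. Si x - (1 - cos x) / x \<le> Si y" using ev
      proof eventually_elim
        case (elim y)
        have "0 \<le> (1 - cos y) / y" using elim False by simp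
        with 1[OF elim] show ?case by linarith
      qed
    qed simp
    have ge: "Si x + (1 + cos x) / x \<ge> pi / 2"
    proof (rule tendsto_upperbound[OF Si_at_top])
      show "\<forall>\<^sub>F y in at_top. Si y \<le> Si x + (1 + cos x) / x" using ev
      proof eventually_elim
        case (elim y)
        have "0 \<le> (1 + cos y) / y"
          using elim False cos_ge_minus_one[of y] by (intro divide_nonneg_nonneg) linarith+
        with 2[OF elim] show ?case by linarith
      qed
    qed simp
    have "(1 - cos x) / x \<le> 2" "(1 + cos x) / x \<le> 2"
      using False cos_ge_minus_one[of x] cos_le_one[of x] by (simp_all add: divide_le_eq, linarith+)
    with le ge pi_gt_zero show ?thesis unfolding abs_le_iff by linarith
  qed
  show ?thesis using main[of x] main[of "- x"] by (cases "0 \<le> x") (auto simp: Si_minus)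
qed

lemma abs_Jfun_le:
  assumes "0 < h"
  shows "\<bar>Jfun k h x\<bar> \<le> (1 + 2 / pi) * h"
proof -
  define s where "s = Si (pi * (x / h - real_of_int k))"
  have "\<bar>1/2 + (1/pi) * s\<bar> \<le> 1/2 + (1/pi) * \<bar>s\<bar>"
    by (rule order_trans[OF abs_triangle_ineq]) (simp add: abs_mult)
  also have "\<dots> \<le> 1/2 + (1/pi) * (pi / 2 + 2)"
    using abs_Si_le by (intro add_left_mono mult_left_mono) (auto simp: s_def)
  also have "\<dots> = 1 + 2 / pi" by (simp add: field_simps)
  finally show ?thesis
    using assms by (simp add: Jfun_def abs_mult mult.commute flip: s_def)
qed

text \<open>\<open>Si\<close> tends to -pi/2 at minus infinity and cancels the 1/2. The points are
  half-integer multiples of h because the lower limits of integration will be zeros of cos(pi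
  t/h).\<close>

lemma tendsto_Jfun_zero:
  assumes "0 < h"
  shows "(\<lambda>j::nat. Jfun k h (- ((real j + 1/2) * h))) \<longlonglongrightarrow> 0"
proof -
  have "filterlim (\<lambda>j::nat. pi * ((1/2 + real_of_int k) + real j)) at_top sequentially"
    by (intro filterlim_tendsto_pos_mult_at_top[OF tendsto_const pi_gt_zero]
        filterlim_tendsto_add_at_top[OF tendsto_const filterlim_real_sequentially])
  then have "(\<lambda>j. Si (pi * ((1/2 + real_of_int k) + real j))) \<longlonglongrightarrow> pi / 2"
    by (rule filterlim_compose[OF Si_at_top])
  then have "(\<lambda>j. h * (1/2 + (1/pi) * - Si (pi * ((1/2 + real_of_int k) + real j)))) \<longlonglongrightarrow> h * (1/2 + (1/pi) * - (pi / 2))"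
    by (intro tendsto_intros)
  moreover have "- ((real j + 1/2) * h) / h - real_of_int k = - ((1/2 + real_of_int k) + real j)" for j
    using assms by simp
  ultimately show ?thesis
    by (simp only: Jfun_def mult_minus_right Si_minus) simp
qed

text \<open>This is why integrating the sinc interpolant in its variable produces the functions
  \<open>Jfun\<close>.\<close>

lemma Jfun_has_real_derivative:
  assumes "0 < h"
  shows "(Jfun k h has_real_derivative sinc (pi * (x / h - real_of_int k))) (at x)"
proof -
  have "((\<lambda>x. h * (1/2 + (1/pi) * Si (pi * (x / h - real_of_int k)))) has_real_derivative
         h * ((1/pi) * (sinc (pi * (x / h - real_of_int k)) * (pi * (1 / h))))) (at x)"
    using assms
    by (intro DERIV_cmult DERIV_chain2[OF DERIV_Si]) (auto intro!: derivative_eq_intros DERIV_chain2[OF DERIV_Si])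
  then show ?thesis using assms by (simp add: Jfun_def[abs_def])
qed

section \<open>Contour representation of the sinc interpolation error\<close>

lemma contour_integral_linepath_same_Im:
  assumes "Im z = c" "Im z' = c" "Re z = a" "Re z' = b" "a < b"
  shows   "contour_integral (linepath z z') f = integral {a..b} (\<lambda>x. f (Complex x c))"
proof -
  have zz': "z = Complex a c" "z' = Complex b c"
    using assms by (auto simp: complex_eq_iff)
  have "contour_integral (linepath z z') f =
         (z' - z) * integral {0..1} (\<lambda>x. f (linepath z z' x))"
    by (simp add: contour_integral_integral)
  also have "z' - z = of_real (b - a)"
    by (simp add: zz' Complex_eq algebra_simps)
  also have "integral {0..1} (\<lambda>x. f (linepath z z' x)) =
             integral {0..(b - a) / (b - a)} (\<lambda>x. f (Complex (a + (b - a) * x) c))"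
    using \<open>a < b\<close> by (simp add: linepath_def Complex_eq scaleR_conv_of_real algebra_simps zz')
  also have "{0..(b - a) / (b - a)} = (\<lambda>x. x / (b - a)) ` {0..b - a}"
    using \<open>a < b\<close> by simp
  also have "integral \<dots> (\<lambda>x. f (Complex (a + (b - a) * x) c)) =
             integral {a-a..b-a} (\<lambda>x. f (Complex (x + a) c)) / of_real (b - a)"
    using \<open>a < b\<close> by (subst integral_stretch_real) (auto simp: scaleR_conv_of_real add_ac)
  also have "\<dots> = integral {a..b} (\<lambda>x. f (Complex x c)) / of_real (b - a)"
    by (subst integral_shift_real_ivl) (rule refl)
  finally show ?thesis
    using \<open>a < b\<close> by simp
qed

lemma contour_integral_rectpath:
  assumes "p < q" "r < s"
    and cont: "continuous_on (path_image (rectpath (Complex p r) (Complex q s))) g"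
  shows "contour_integral (rectpath (Complex p r) (Complex q s)) g =
           integral {p..q} (\<lambda>x. g (Complex x r)) + \<i> * integral {r..s} (\<lambda>y. g (Complex q y))
         - integral {p..q} (\<lambda>x. g (Complex x s)) - \<i> * integral {r..s} (\<lambda>y. g (Complex p y))"
proof -
  let ?a1 = "Complex p r" and ?a2 = "Complex q r" and ?a3 = "Complex q s" and ?a4 = "Complex p s"
  have "path_image (rectpath ?a1 ?a3) =
          closed_segment ?a1 ?a2 \<union> closed_segment ?a2 ?a3 \<union> closed_segment ?a3 ?a4 \<union> closed_segment ?a4 ?a1"
    by (simp add: rectpath_def Let_def path_image_join Un_assoc)
  then have int: "g contour_integrable_on linepath ?a1 ?a2" "g contour_integrable_on linepath ?a2 ?a3"
      "g contour_integrable_on linepath ?a3 ?a4" "g contour_integrable_on linepath ?a4 ?a1"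
    by (auto intro!: contour_integrable_continuous_linepath continuous_on_subset[OF cont])
  have "contour_integral (rectpath ?a1 ?a3) g =
          contour_integral (linepath ?a1 ?a2) g + contour_integral (linepath ?a2 ?a3) g
        + contour_integral (linepath ?a3 ?a4) g + contour_integral (linepath ?a4 ?a1) g"
    using int by (simp add: rectpath_def Let_def add_ac)
  also have "contour_integral (linepath ?a3 ?a4) g = - contour_integral (linepath ?a4 ?a3) g"
    using contour_integral_reversepath[OF valid_path_linepath, of ?a4 ?a3 g] by simp
  also have "contour_integral (linepath ?a4 ?a1) g = - contour_integral (linepath ?a1 ?a4) g"
    using contour_integral_reversepath[OF valid_path_linepath, of ?a1 ?a4 g] by simp
  finally show ?thesis
    using assms
    by (simp add: contour_integral_linepath_same_Im[where c = r and a = p and b = q]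
        contour_integral_linepath_same_Im[where c = s and a = p and b = q]
        contour_integral_linepath_same_Re[where c = p and a = r and b = s]
        contour_integral_linepath_same_Re[where c = q and a = r and b = s])
qed

lemma complex_sin_scaled_eq_0_iff:
  assumes "0 < h"
  shows "sin (complex_of_real (pi / h) * z) = 0 \<longleftrightarrow> (\<exists>k::int. z = of_real (k * h))"
proof -
  have "complex_of_real (pi / h) * z = of_real (k * pi) \<longleftrightarrow> z = of_real (k * h)" for k :: int
    using assms by (simp add: field_simps)
  then show ?thesis by (simp only: sin_eq_0)
qed

text \<open>The sine has a simple zero at kh with derivative (pi/h) cos(pi k), and the remaining
  factor is regular there because t differs from kh.\<close>

lemma residue_sinc_kernel:
  fixes F :: "complex \<Rightarrow> complex" and k :: int and h :: real
  assumes h: "0 < h" and U: "open U" "F holomorphic_on U" "of_real (k * h) \<in> U"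
    and t: "t \<noteq> of_real (k * h)"
  shows "residue (\<lambda>w. F w * c / ((w - t) * sin (complex_of_real (pi / h) * w))) (of_real (k * h))
           = F (of_real (k * h)) * c * of_real (h / (pi * cos (pi * k))) / (of_real (k * h) - t)"
proof (rule residue_simple')
  let ?z = "complex_of_real (k * h)" and ?S = "\<lambda>w. sin (complex_of_real (pi / h) * w)"
  \<comment> \<open>Neighbouring zeros of the sine are h apart, so the open ball of radius h
    contains only the zero at its centre.\<close>
  define V where "V = U \<inter> ball ?z h - {t}"
  show "open V" using U by (auto simp: V_def intro: open_delete)
  show "?z \<in> V" using U h t by (auto simp: V_def)
  have nz: "?S w \<noteq> 0" if w: "w \<in> V - {?z}" for w
  proof
    assume "?S w = 0"
    then obtain j :: int where j: "w = of_real (j * h)"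
      using complex_sin_scaled_eq_0_iff[OF h] by blast
    then have "norm (complex_of_real ((k - j) * h)) < h"
      using w by (auto simp: V_def dist_norm algebra_simps)
    then have "\<bar>real_of_int (k - j)\<bar> * h < 1 * h"
      using h by (simp only: norm_of_real abs_mult abs_of_pos)
    then have "\<bar>real_of_int (k - j)\<bar> < 1" using h by simp
    then have "k = j" by linarith
    with j w show False by simp
  qed
  show "(\<lambda>w. F w * c / ((w - t) * ?S w)) holomorphic_on V - {?z}"
    using nz by (auto intro!: holomorphic_intros holomorphic_on_subset[OF U(2)] simp: V_def)
  have ph: "complex_of_real (pi / h) * ?z = of_real (pi * k)" using h by simp
  have S0: "?S ?z = 0" using complex_sin_scaled_eq_0_iff[OF h] by blast
  have eq: "cos (complex_of_real (pi / h) * ?z) * of_real (pi / h) = of_real (cos (pi * k) * (pi / h))"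
    unfolding ph cos_of_real by (simp only: of_real_mult)
  have "(?S has_field_derivative cos (complex_of_real (pi / h) * ?z) * of_real (pi / h)) (at ?z)"
    by (auto intro!: derivative_eq_intros)
  then have "((\<lambda>w. ?S w / (w - ?z)) \<longlongrightarrow> of_real (cos (pi * k) * (pi / h))) (at ?z)"
    by (simp only: has_field_derivative_iff S0 diff_zero eq)
  moreover have ck: "cos (pi * k) \<noteq> 0"
    using sin_cos_squared_add[of "pi * k"] sin_integer_2pi sin_zero_iff_int2[of "pi * k"]
    by (auto simp: mult.commute)
  moreover have "(F \<longlongrightarrow> F ?z) (at ?z)"
    using U by (meson continuous_on_eq_continuous_at holomorphic_on_imp_continuous_on isCont_def)
  ultimately have "((\<lambda>w. F w * c / (w - t) / (?S w / (w - ?z)))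
      \<longlongrightarrow> F ?z * c / (?z - t) / of_real (cos (pi * k) * (pi / h))) (at ?z)"
    using t h by (intro tendsto_intros) auto
  then show "((\<lambda>w. F w * c / ((w - t) * ?S w) * (w - ?z))
      \<longlongrightarrow> F ?z * c * of_real (h / (pi * cos (pi * k))) / (?z - t)) (at ?z)"
    by (simp add: field_simps)
qed

lemma sin_eq_cos_mult_sin_shift:
  fixes k :: int
  shows "sin x = cos (pi * k) * sin (x - pi * k)"
  by (simp add: sin_diff algebra_simps sin_zero_iff_int2)

text \<open>In the residue theorem the pole at t contributes F(t), and those at kh contribute minus
  the sinc terms, because sin(pi t/h) = cos(pi k) sin(pi (t/h - k)). The half-integer in
  \<open>T\<close> puts the vertical sides midway between grid points.\<close>

lemma sinc_interpolation_rectpath: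
  fixes F :: "complex \<Rightarrow> complex" and h t d e :: real and m :: nat
  defines "T \<equiv> (real m + 1/2) * h"
  assumes h: "0 < h" and F: "F holomorphic_on strip d" and e: "0 < e" "e < d" and t: "\<bar>t\<bar> < T"
  shows "contour_integral (rectpath (Complex (- T) (- e)) (Complex T e))
           (\<lambda>w. F w * sin (of_real (pi / h * t)) / ((w - of_real t) * sin (complex_of_real (pi / h) * w)))
         = 2 * pi * \<i> * (F (of_real t)
             - (\<Sum>k\<in>{- int m..int m}. F (of_real (k * h)) * of_real (sinc (pi * (t / h - k)))))"
    (is "contour_integral ?R ?\<Phi> = _")
\<comment> \<open>At a grid point t the pole of 1/(w - t) would merge with a zero of the sine. There
  the factor sin(pi t/h) annihilates the integrand and the sum collapses to F(t), so both sides are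
  0.\<close>
proof (cases "sin (complex_of_real (pi / h) * of_real t) = 0")
  case True
  then have s0: "sin (complex_of_real (pi / h * t)) = 0" by simp
  obtain j :: int where "complex_of_real t = of_real (j * h)"
    using True complex_sin_scaled_eq_0_iff[OF h] by blast
  then have j: "t = j * h" using of_real_eq_iff by blast
  have "\<bar>real_of_int j\<bar> * h < (real m + 1/2) * h" using t h by (simp add: j T_def abs_mult)
  then have "\<bar>real_of_int j\<bar> < real m + 1/2" using h by simp
  then have jm: "j \<in> {- int m..int m}" by auto
  have "sinc (pi * (t / h - k)) = (if k = j then 1 else 0)" for k :: int
  proof -
    have "pi * (t / h - k) = real_of_int (j - k) * pi" using h by (simp add: j algebra_simps)
    moreover have "sin (real_of_int (j - k) * pi) = 0" using sin_zero_iff_int2 by blast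
    ultimately show ?thesis by (simp only:) auto
  qed
  then have "(\<Sum>k\<in>{- int m..int m}. F (of_real (k * h)) * of_real (sinc (pi * (t / h - k))))
      = (\<Sum>k\<in>{- int m..int m}. if k = j then F (of_real (j * h)) else 0)"
    by (intro sum.cong) auto
  also have "\<dots> = F (of_real t)" using jm j by (simp only: sum.delta finite_atLeastAtMost_int if_True)
  finally have "2 * pi * \<i> * (F (of_real t)
             - (\<Sum>k\<in>{- int m..int m}. F (of_real (k * h)) * of_real (sinc (pi * (t / h - k))))) = 0"
    by (simp only: diff_self mult_zero_right)
  moreover have "contour_integral ?R ?\<Phi> = contour_integral ?R (\<lambda>w. 0)"
    by (simp only: s0 mult_zero_right div_0)
  ultimately show ?thesis by (simp only: contour_integral_0)
next
  case False
  let ?S = "\<lambda>w. sin (complex_of_real (pi / h) * w)" and ?p = "\<lambda>k::int. complex_of_real (k * h)"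
  define c where "c = sin (complex_of_real (pi / h * t))"
  have c: "c = ?S (of_real t)" "c \<noteq> 0" using False by (simp_all add: c_def)
  have tk: "of_real t \<noteq> ?p k" for k
    using False complex_sin_scaled_eq_0_iff[OF h] by blast
  \<comment> \<open>The open box of half-width (m + 1) h contains the rectangle, yet of the real
    grid points only those with |k| \<le> m.\<close>
  define T' where "T' = (real m + 1) * h"
  define U where "U = box (Complex (- T') (- d)) (Complex T' d)"
  define pts where "pts = insert (of_real t) (?p ` {- int m..int m})"
  have TT: "T < T'" "0 < T" using h by (auto simp: T_def T'_def)
  have FU: "F holomorphic_on U"
    by (rule holomorphic_on_subset[OF F]) (auto simp: U_def strip_def in_box_complex_iff)
  have pk: "?p k \<in> box (Complex (- T) (- e)) (Complex T e)" if "k \<in> {- int m..int m}" for k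
  proof -
    have "\<bar>real_of_int k\<bar> < real m + 1/2" using that by auto
    then have "\<bar>real_of_int k\<bar> * h < T" unfolding T_def using h by (intro mult_strict_right_mono)
    then have "\<bar>real_of_int k * h\<bar> < T" using h by (simp add: abs_mult)
    then show ?thesis using e by (auto simp: in_box_complex_iff)
  qed
  have pts_box: "z \<in> box (Complex (- T) (- e)) (Complex T e)" if "z \<in> pts" for z
    using that pk t e by (auto simp: pts_def in_box_complex_iff)
  have zero: "w \<in> pts" if w: "w \<in> U" "?S w = 0" for w
  proof -
    obtain k :: int where k: "w = ?p k" using w complex_sin_scaled_eq_0_iff[OF h] by blast
    have "\<bar>real_of_int k * h\<bar> < T'" using w(1) by (auto simp: k U_def in_box_complex_iff)
    then have "\<bar>real_of_int k\<bar> * h < (real m + 1) * h" using h by (simp add: T'_def abs_mult)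
    then have "\<bar>real_of_int k\<bar> < real m + 1" using h by simp
    then have "k \<in> {- int m..int m}" by auto
    then show ?thesis by (auto simp: k pts_def)
  qed
  have im: "path_image ?R = cbox (Complex (- T) (- e)) (Complex T e) - box (Complex (- T) (- e)) (Complex T e)"
    using TT e by (intro path_image_rectpath_cbox_minus_box) auto
  have imU: "path_image ?R \<subseteq> U"
    unfolding im using TT e by (auto simp: U_def in_box_complex_iff in_cbox_complex_iff)
  have "contour_integral ?R ?\<Phi> = 2 * pi * \<i> * (\<Sum>p\<in>pts. winding_number ?R p * residue ?\<Phi> p)"
  proof (rule Residue_theorem)
    show "open U" "connected U" by (auto simp: U_def convex_connected convex_box)
    show "finite pts" by (simp add: pts_def)
    show "?\<Phi> holomorphic_on U - pts"
      using zero by (intro holomorphic_intros holomorphic_on_subset[OF FU]) (auto simp: pts_def)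
    show "path_image ?R \<subseteq> U - pts" using im imU pts_box by auto
    show "\<forall>z. z \<notin> U \<longrightarrow> winding_number ?R z = 0"
      using imU by (auto intro!: winding_number_zero_outside[of _ U] simp: U_def convex_box)
  qed auto
  also have "(\<Sum>p\<in>pts. winding_number ?R p * residue ?\<Phi> p) = (\<Sum>p\<in>pts. residue ?\<Phi> p)"
    by (intro sum.cong) (simp_all add: winding_number_rectpath pts_box)
  also have "\<dots> = residue ?\<Phi> (of_real t) + (\<Sum>p\<in>?p ` {- int m..int m}. residue ?\<Phi> p)"
    unfolding pts_def using tk by (subst sum.insert) auto
  also have "(\<Sum>p\<in>?p ` {- int m..int m}. residue ?\<Phi> p) = (\<Sum>k\<in>{- int m..int m}. residue ?\<Phi> (?p k))"
    using h by (subst sum.reindex) (auto simp: inj_on_def)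
  also have "\<dots> = (\<Sum>k\<in>{- int m..int m}. - (F (of_real (k * h)) * of_real (sinc (pi * (t / h - k)))))"
  proof (rule sum.cong[OF refl])
    fix k :: int assume k: "k \<in> {- int m..int m}"
    have "?p k \<in> U" using pk[OF k] TT e by (auto simp: U_def in_box_complex_iff)
    then have "residue ?\<Phi> (?p k) = F (?p k) * c * of_real (h / (pi * cos (pi * k))) / (?p k - of_real t)"
      unfolding c_def using h tk[of k]
      by (intro residue_sinc_kernel[where U = U] FU) (auto simp: U_def)
    also have "\<dots> = F (?p k) * of_real (sin (pi / h * t) * (h / (pi * cos (pi * k))) / (k * h - t))"
      by (simp add: c_def flip: sin_of_real)
    also have "sin (pi / h * t) * (h / (pi * cos (pi * k))) / (k * h - t) = - sinc (pi * (t / h - k))"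
    proof -
      have "t \<noteq> k * h" using tk[of k] by auto
      then have ne: "pi * (t / h - k) \<noteq> 0" using h by (auto simp: field_simps)
      have ck: "cos (pi * k) \<noteq> 0"
        using sin_cos_squared_add[of "pi * k"] sin_zero_iff_int2[of "pi * k"] by (auto simp: mult.commute)
      have "sin (pi / h * t) = cos (pi * k) * sin (pi * (t / h - k))"
        using sin_eq_cos_mult_sin_shift[of "pi / h * t" k] by (simp add: algebra_simps)
      then show ?thesis using ne ck h \<open>t \<noteq> k * h\<close> by (simp add: field_simps)
    qed
    finally show "residue ?\<Phi> (?p k) = - (F (?p k) * of_real (sinc (pi * (t / h - k))))" by simp
  qed
  also have "residue ?\<Phi> (of_real t) = F (of_real t)"
  proof -
    let ?V = "{w \<in> U. ?S w \<noteq> 0}"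
    have "continuous_on U ?S" by (intro continuous_intros)
    then have "open {w \<in> U. ?S w \<in> - {0}}"
      by (rule continuous_open_preimage[unfolded vimage_def Int_def, simplified]) (auto simp: U_def)
    then have "open ?V" by simp
    moreover have "of_real t \<in> ?V"
      using t TT e c by (auto simp: U_def in_box_complex_iff)
    moreover have "(\<lambda>w. F w * c / ?S w) holomorphic_on ?V"
      by (intro holomorphic_intros holomorphic_on_subset[OF FU]) auto
    ultimately have "residue (\<lambda>w. F w * c / ?S w / (w - of_real t)) (of_real t) = F (of_real t) * c / ?S (of_real t)"
      by (rule residue_simple)
    moreover have "?\<Phi> = (\<lambda>w. F w * c / ?S w / (w - of_real t))"
      by (rule ext) (simp add: c_def mult.commute)
    ultimately show ?thesis using c by simp
  qed
  finally show ?thesis by (simp add: sum_negf)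
qed

section \<open>Kernel estimates on the sides of the rectangle\<close>

text \<open>Fubini for a jointly continuous kernel. Integrating in t first gives access to the
  oscillation of sin(pi t/h).\<close>

lemma norm_integral_swap_le:
  fixes k :: "real \<Rightarrow> real \<Rightarrow> complex"
  assumes cont: "continuous_on ({p..q} \<times> {a..x}) (\<lambda>(u, t). k u t)"
    and B: "B integrable_on {p..q}" "\<And>u. u \<in> {p..q} \<Longrightarrow> norm (integral {a..x} (k u)) \<le> B u"
  shows "(\<lambda>t. integral {p..q} (\<lambda>u. k u t)) integrable_on {a..x}"
    and "norm (integral {a..x} (\<lambda>t. integral {p..q} (\<lambda>u. k u t))) \<le> integral {p..q} B"
proof -
  have "continuous_on ({a..x} \<times> {p..q}) ((\<lambda>(u, t). k u t) \<circ> prod.swap)"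
    by (intro continuous_on_compose continuous_on_swap continuous_on_subset[OF cont]) auto
  then have sw: "continuous_on ({a..x} \<times> {p..q}) (\<lambda>(t, u). k u t)"
    by (simp add: o_def case_prod_beta')
  then have "continuous_on {a..x} (\<lambda>t. integral (cbox p q) (\<lambda>u. k u t))"
    by (intro integral_continuous_on_param) simp
  then show "(\<lambda>t. integral {p..q} (\<lambda>u. k u t)) integrable_on {a..x}"
    by (simp add: integrable_continuous_interval)
  have "continuous_on {p..q} (\<lambda>u. integral (cbox a x) (k u))"
    using cont by (intro integral_continuous_on_param) simp
  then have int: "(\<lambda>u. integral {a..x} (k u)) integrable_on {p..q}"
    by (simp add: integrable_continuous_interval)
  have "integral (cbox a x) (\<lambda>t. integral (cbox p q) (\<lambda>u. k u t)) = integral (cbox p q) (\<lambda>u. integral (cbox a x) (k u))"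
    using sw by (intro integral_swap_continuous) (simp add: cbox_Pair_eq)
  then have "norm (integral {a..x} (\<lambda>t. integral {p..q} (\<lambda>u. k u t))) = norm (integral {p..q} (\<lambda>u. integral {a..x} (k u)))"
    by simp
  also have "\<dots> \<le> integral {p..q} B"
    by (rule integral_norm_bound_integral[OF int B])
  finally show "norm (integral {a..x} (\<lambda>t. integral {p..q} (\<lambda>u. k u t))) \<le> integral {p..q} B" .
qed

text \<open>In effect |sin z|^2 = sin^2(Re z) + sinh^2(Im z). This controls the denominator on the
  horizontal sides.\<close>

lemma sinh_abs_Im_le_norm_sin: "sinh \<bar>Im z\<bar> \<le> norm (sin z)"
proof (rule power2_le_imp_le)
  have "(sinh \<bar>Im z\<bar>)\<^sup>2 = (exp (2 * Im z) + inverse (exp (2 * Im z)) - 2) / 4"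
    by (cases "0 \<le> Im z") (simp_all add: sinh_def power2_eq_square field_simps exp_minus flip: exp_add)
  also have "\<dots> \<le> (norm (sin z))\<^sup>2"
    unfolding norm_sin_squared using cos_le_one[of "2 * Re z"] by (intro divide_right_mono) linarith+
  finally show "(sinh \<bar>Im z\<bar>)\<^sup>2 \<le> (norm (sin z))\<^sup>2" .
qed simp

text \<open>Where cos(Re z) vanishes, |sin z| = cosh(Im z). This controls the denominator on the
  vertical sides, which sit at half-integer multiples of h.\<close>

lemma one_le_norm_sin:
  assumes "cos (Re z) = 0"
  shows "1 \<le> norm (sin z)"
proof (rule power2_le_imp_le)
  have "2 \<le> exp (2 * Im z) + inverse (exp (2 * Im z))"
    using exp_ge_add_one_self[of "2 * Im z"] exp_ge_add_one_self[of "- (2 * Im z)"]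
    unfolding exp_minus by linarith
  moreover have "cos (2 * Re z) = - 1" using assms by (simp add: cos_double_cos)
  ultimately show "1\<^sup>2 \<le> (norm (sin z))\<^sup>2"
    unfolding norm_sin_squared by simp
qed simp

text \<open>Integration by parts; the boundary term at \<open>a\<close> vanishes by the choice of \<open>a\<close>.\<close>

lemma norm_integral_sin_kernel_le:
  fixes a x \<omega> :: real
  assumes \<omega>: "0 < \<omega>" and ax: "a \<le> x" and a: "cos (\<omega> * a) = 0" and w: "Im w \<noteq> 0"
  shows "norm (integral {a..x} (\<lambda>t. sin (complex_of_real (\<omega> * t)) / (w - of_real t))) \<le> (1 + pi) / (\<omega> * \<bar>Im w\<bar>)"
proof -
  define D where "D = \<bar>Im w\<bar>"
  have D: "0 < D" using w by (simp add: D_def)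
  have ne: "w - of_real t \<noteq> 0" for t :: real
    using w by (metis Im_complex_of_real eq_iff_diff_eq_0)
  have nw: "D \<le> norm (w - of_real t)" for t :: real
    using abs_Im_le_cmod[of "w - of_real t"] by (simp add: D_def)
  \<comment> \<open>The derivative of \<open>?A\<close> is the kernel minus \<open>?r\<close>. The
    remainder \<open>?r\<close> has a second power of w - t in its denominator, so it is absolutely
    integrable over the whole line.\<close>
  let ?A = "\<lambda>t::real. - (of_real (cos (\<omega> * t)) / (of_real \<omega> * (w - of_real t)))"
  let ?r = "\<lambda>t::real. of_real (cos (\<omega> * t)) / (of_real \<omega> * (w - of_real t)\<^sup>2)"
  have "((\<lambda>t. sin (complex_of_real (\<omega> * t)) / (w - of_real t) - ?r t) has_integral (?A x - ?A a)) {a..x}"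
  proof (rule fundamental_theorem_of_calculus[OF ax])
    fix t
    have "((\<lambda>t. - (cos (of_real \<omega> * t) / (of_real \<omega> * (w - t)))) has_field_derivative
        sin (of_real \<omega> * of_real t) / (w - of_real t) - cos (of_real \<omega> * of_real t) / (of_real \<omega> * (w - of_real t)\<^sup>2)) (at (of_real t))"
    proof -
      define v where "v = w - of_real t"
      have v: "v \<noteq> 0" using ne by (simp add: v_def)
      have "((\<lambda>t. - (cos (of_real \<omega> * t) / (of_real \<omega> * (w - t)))) has_field_derivative
          - ((- sin (of_real \<omega> * of_real t) * of_real \<omega> * (of_real \<omega> * v) - cos (of_real \<omega> * of_real t) * - of_real \<omega>)
             / (of_real \<omega> * v * (of_real \<omega> * v)))) (at (of_real t))"
        using v \<omega> unfolding v_def by (auto intro!: derivative_eq_intros)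
      also have "- ((- sin (of_real \<omega> * of_real t) * of_real \<omega> * (of_real \<omega> * v) - cos (of_real \<omega> * of_real t) * - of_real \<omega>)
             / (of_real \<omega> * v * (of_real \<omega> * v)))
          = sin (of_real \<omega> * of_real t) / v - cos (of_real \<omega> * of_real t) / (of_real \<omega> * v\<^sup>2)"
        using v \<omega> by (simp add: field_simps power2_eq_square)
      finally show ?thesis by (simp only: v_def)
    qed
    from has_vector_derivative_real_field[OF this]
    show "(?A has_vector_derivative sin (complex_of_real (\<omega> * t)) / (w - of_real t) - ?r t) (at t within {a..x})"
      by (simp flip: cos_of_real)
  qed
  moreover have rint: "?r integrable_on {a..x}"
    using ne \<omega> by (intro integrable_continuous_interval continuous_intros) auto
  then have "(?r has_integral integral {a..x} ?r) {a..x}" by blast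
  ultimately have "((\<lambda>t. (sin (complex_of_real (\<omega> * t)) / (w - of_real t) - ?r t) + ?r t)
      has_integral (?A x - ?A a + integral {a..x} ?r)) {a..x}"
    by (rule has_integral_add)
  then have eq: "integral {a..x} (\<lambda>t. sin (complex_of_real (\<omega> * t)) / (w - of_real t)) = ?A x + integral {a..x} ?r"
    using a by (simp add: has_integral_iff)
  \<comment> \<open>Antiderivative of the bound on the modulus of \<open>?r\<close>. The arctangent
    varies by less than pi, which gives the pi in 1 + pi; the 1 comes from the boundary term at
    x.\<close>
  let ?B = "\<lambda>t. arctan ((t - Re w) / D) / (\<omega> * D)"
  have Bint: "((\<lambda>t. 1 / (\<omega> * ((t - Re w)\<^sup>2 + D\<^sup>2))) has_integral (?B x - ?B a)) {a..x}"
  proof (rule fundamental_theorem_of_calculus[OF ax])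
    fix t
    have pos: "0 < (t - Re w)\<^sup>2 + D\<^sup>2" using D by (simp add: add_nonneg_pos)
    have "(?B has_real_derivative inverse (1 + ((t - Re w) / D)\<^sup>2) * (1 / D) / (\<omega> * D)) (at t within {a..x})"
      using D \<omega> by (auto intro!: derivative_eq_intros)
    also have "inverse (1 + ((t - Re w) / D)\<^sup>2) * (1 / D) / (\<omega> * D) = 1 / (\<omega> * ((t - Re w)\<^sup>2 + D\<^sup>2))"
    proof -
      have "1 + ((t - Re w) / D)\<^sup>2 = ((t - Re w)\<^sup>2 + D\<^sup>2) / D\<^sup>2"
        using D by (simp add: field_simps)
      then show ?thesis using D \<omega> pos by (simp add: power2_eq_square)
    qed
    finally show "(?B has_vector_derivative 1 / (\<omega> * ((t - Re w)\<^sup>2 + D\<^sup>2))) (at t within {a..x})"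
      by (simp add: has_real_derivative_iff_has_vector_derivative)
  qed
  have "norm (integral {a..x} ?r) \<le> integral {a..x} (\<lambda>t. 1 / (\<omega> * ((t - Re w)\<^sup>2 + D\<^sup>2)))"
  proof (rule integral_norm_bound_integral[OF rint])
    show "(\<lambda>t. 1 / (\<omega> * ((t - Re w)\<^sup>2 + D\<^sup>2))) integrable_on {a..x}" using Bint by blast
    fix t
    have "(norm (w - of_real t))\<^sup>2 = (t - Re w)\<^sup>2 + D\<^sup>2"
      by (simp add: cmod_power2 D_def power2_commute)
    then have "norm (?r t) = \<bar>cos (\<omega> * t)\<bar> / (\<omega> * ((t - Re w)\<^sup>2 + D\<^sup>2))"
      using \<omega> by (simp add: norm_divide norm_mult norm_power)
    also have "\<dots> \<le> 1 / (\<omega> * ((t - Re w)\<^sup>2 + D\<^sup>2))"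
      using \<omega> by (intro divide_right_mono) auto
    finally show "norm (?r t) \<le> 1 / (\<omega> * ((t - Re w)\<^sup>2 + D\<^sup>2))" .
  qed
  also have "\<dots> = (arctan ((x - Re w) / D) - arctan ((a - Re w) / D)) / (\<omega> * D)"
    using Bint by (simp add: has_integral_iff diff_divide_distrib)
  also have "\<dots> \<le> pi / (\<omega> * D)"
    using arctan_ubound[of "(x - Re w) / D"] arctan_lbound[of "(a - Re w) / D"] \<omega> D
    by (intro divide_right_mono) auto
  finally have 1: "norm (integral {a..x} ?r) \<le> pi / (\<omega> * D)" .
  have "norm (?A x) = \<bar>cos (\<omega> * x)\<bar> / (\<omega> * norm (w - of_real x))"
    using \<omega> by (simp add: norm_divide norm_mult)
  also have "\<dots> \<le> 1 / (\<omega> * D)"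
    using \<omega> D nw[of x] by (intro frac_le mult_left_mono) auto
  finally have "norm (?A x) \<le> 1 / (\<omega> * D)" .
  with 1 show ?thesis unfolding eq
    by (simp only: add_divide_distrib flip: D_def) (smt (verit) norm_triangle_ineq)
qed

text \<open>Treats one side of the rectangle, parametrized by \<gamma>. After the exchange of
  integrals, F / sin does not depend on t and leaves the inner integral, so only the sine kernel
  remains to be estimated.\<close>

lemma norm_integral_kernel_path_le:
  fixes F :: "complex \<Rightarrow> complex" and \<gamma> :: "real \<Rightarrow> complex" and \<omega> :: real
  assumes F: "continuous_on S F" and \<gamma>: "continuous_on {p..q} \<gamma>" "\<gamma> ` {p..q} \<subseteq> S"
    and nz: "\<And>u. u \<in> {p..q} \<Longrightarrow> sin (of_real \<omega> * \<gamma> u) \<noteq> 0"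
    and off: "\<And>u t. u \<in> {p..q} \<Longrightarrow> t \<in> {a..x} \<Longrightarrow> \<gamma> u \<noteq> of_real t"
    and B: "B integrable_on {p..q}"
      "\<And>u. u \<in> {p..q} \<Longrightarrow> norm (F (\<gamma> u) / sin (of_real \<omega> * \<gamma> u))
          * norm (integral {a..x} (\<lambda>t. sin (complex_of_real (\<omega> * t)) / (\<gamma> u - of_real t))) \<le> B u"
  defines "I \<equiv> \<lambda>t. integral {p..q} (\<lambda>u. F (\<gamma> u) * sin (of_real (\<omega> * t)) / ((\<gamma> u - of_real t) * sin (of_real \<omega> * \<gamma> u)))"
  shows "I integrable_on {a..x}" and "norm (integral {a..x} I) \<le> integral {p..q} B"
proof -
  let ?k = "\<lambda>u t. F (\<gamma> u) * sin (complex_of_real (\<omega> * t)) / ((\<gamma> u - of_real t) * sin (of_real \<omega> * \<gamma> u))"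
  have F\<gamma>: "continuous_on ({p..q} \<times> {a..x}) (\<lambda>z. F (\<gamma> (fst z)))"
    using \<gamma>(2) by (intro continuous_on_compose2[OF F] continuous_on_compose2[OF \<gamma>(1)] continuous_intros) auto
  have cont: "continuous_on ({p..q} \<times> {a..x}) (\<lambda>(u, t). ?k u t)"
    unfolding case_prod_beta'
    by (intro continuous_intros F\<gamma> continuous_on_compose2[OF \<gamma>(1)])
       (use nz off in \<open>fastforce+\<close>)
  have bd: "norm (integral {a..x} (?k u)) \<le> B u" if u: "u \<in> {p..q}" for u
  proof -
    have "?k u = (\<lambda>t. F (\<gamma> u) / sin (of_real \<omega> * \<gamma> u) * (sin (complex_of_real (\<omega> * t)) / (\<gamma> u - of_real t)))"
      by (rule ext) (simp add: mult.commute)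
    then have "norm (integral {a..x} (?k u)) = norm (F (\<gamma> u) / sin (of_real \<omega> * \<gamma> u))
          * norm (integral {a..x} (\<lambda>t. sin (complex_of_real (\<omega> * t)) / (\<gamma> u - of_real t)))"
      by (simp only: integral_mult_right norm_mult)
    with B(2)[OF u] show ?thesis by simp
  qed
  from norm_integral_swap_le[OF cont B(1) bd]
  show "I integrable_on {a..x}" "norm (integral {a..x} I) \<le> integral {p..q} B"
    unfolding I_def by auto
qed

text \<open>\<open>- exp (- b * sinh u) / b\<close> is a primitive on the right half, and the
  integrand is even. Each half contributes at most 1/b, whatever \<open>T\<close> is.\<close>

lemma cosh_exp_abs_sinh_integral:
  fixes b T :: real
  assumes b: "0 < b" and T: "0 \<le> T"
  shows "(\<lambda>u. cosh u * exp (- b * \<bar>sinh u\<bar>)) integrable_on {-T..T}"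
    and "integral {-T..T} (\<lambda>u. cosh u * exp (- b * \<bar>sinh u\<bar>)) \<le> 2 / b"
proof -
  let ?g = "\<lambda>u. cosh u * exp (- b * \<bar>sinh u\<bar>)"
  have 1: "(?g has_integral (1 - exp (- b * sinh T)) / b) {0..T}"
  proof -
    have "((\<lambda>u. cosh u * exp (- b * sinh u)) has_integral (- exp (- b * sinh T) / b - (- exp (- b * sinh 0) / b))) {0..T}"
      using b by (intro fundamental_theorem_of_calculus[OF T])
        (auto intro!: derivative_eq_intros simp flip: has_real_derivative_iff_has_vector_derivative)
    then have "((\<lambda>u. cosh u * exp (- b * sinh u)) has_integral (1 - exp (- b * sinh T)) / b) {0..T}"
      by (simp add: diff_divide_distrib)
    then show ?thesis by (rule has_integral_eq[rotated]) simp
  qed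
  have "((\<lambda>u. ?g (- u)) has_integral (1 - exp (- b * sinh T)) / b) {- T..- 0}"
    using 1 by (subst has_integral_reflect_real) simp
  then have 2: "(?g has_integral (1 - exp (- b * sinh T)) / b) {- T..0}"
    by simp
  have 3: "(?g has_integral ((1 - exp (- b * sinh T)) / b + (1 - exp (- b * sinh T)) / b)) {- T..T}"
    using T by (intro has_integral_combine[OF _ _ 2 1]) auto
  then show "?g integrable_on {-T..T}" by blast
  have "integral {-T..T} ?g = 2 * ((1 - exp (- b * sinh T)) / b)" using 3 by (simp add: has_integral_iff)
  also have "\<dots> \<le> 2 * (1 / b)" using b by (intro mult_left_mono divide_right_mono) auto
  finally show "integral {-T..T} ?g \<le> 2 / b" by simp
qed

lemma norm_integral_four_sides_le:
  fixes g1 g2 g3 g4 :: "real \<Rightarrow> complex"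
  assumes "g1 integrable_on S" "g2 integrable_on S" "g3 integrable_on S" "g4 integrable_on S"
  shows "norm (integral S (\<lambda>t. g1 t + \<i> * g2 t - g3 t - \<i> * g4 t))
    \<le> norm (integral S g1) + norm (integral S g2) + norm (integral S g3) + norm (integral S g4)"
proof -
  have "integral S (\<lambda>t. g1 t + \<i> * g2 t - g3 t - \<i> * g4 t)
      = integral S g1 + \<i> * integral S g2 - integral S g3 - \<i> * integral S g4"
    using assms
    by (simp add: integral_add integral_diff integrable_add integrable_diff integrable_on_mult_right)
  also have "norm \<dots> \<le> norm (integral S g1 + \<i> * integral S g2) + norm (integral S g3) + norm (\<i> * integral S g4)"
    by (meson add_right_mono norm_triangle_ineq4 order_trans)
  also have "\<dots> \<le> norm (integral S g1) + norm (\<i> * integral S g2) + norm (integral S g3) + norm (\<i> * integral S g4)"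
    by (intro add_right_mono norm_triangle_ineq)
  finally show ?thesis by (simp add: norm_mult)
qed

section \<open>Discretization error on a finite rectangle\<close>

text \<open>Integrates the contour identity over t in [a, x]. The horizontal sides get the sharp
  kernel estimate. The vertical ones get a crude bound, the length 2e times a supremum times x - a,
  which still vanishes as m grows.\<close>

lemma sinc_indefinite_error_rectpath:
  fixes F :: "complex \<Rightarrow> complex" and h d e a x b C :: real and m :: nat
  defines "T \<equiv> (real m + 1/2) * h"
  assumes h: "0 < h" and F: "F holomorphic_on strip d" and e: "0 < e" "e < d"
    and ax: "a < x" and a: "cos (pi / h * a) = 0" and aT: "\<bar>a\<bar> + 1 \<le> T" and xT: "\<bar>x\<bar> + 1 \<le> T"
    and b: "0 < b" and C: "0 \<le> C"
    and bound: "\<And>u y. \<bar>y\<bar> \<le> e \<Longrightarrow> norm (F (Complex u y)) \<le> C * (cosh u * exp (- b * \<bar>sinh u\<bar>))"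
  shows "norm (integral {a..x} (\<lambda>t. F (of_real t))
           - (\<Sum>k\<in>{- int m..int m}. F (of_real (k * h)) * of_real (Jfun k h x - Jfun k h a)))
         \<le> (2 * (C * (2 / b) / sinh (pi / h * e) * ((1 + pi) / (pi / h * e)))
             + 2 * (2 * e * (C * (cosh T * exp (- b * sinh T)) * (x - a)))) / (2 * pi)"
proof -
  define \<omega> where "\<omega> = pi / h"
  have \<omega>: "0 < \<omega>" using h by (simp add: \<omega>_def)
  have T: "0 < T" using h by (simp add: T_def)
  have stripI: "Complex u y \<in> strip d" if "\<bar>y\<bar> \<le> e" for u y using that e by (simp add: strip_def)
  have contF: "continuous_on (strip d) F" using F by (rule holomorphic_on_imp_continuous_on)
  have cC: "continuous_on A (\<lambda>u. Complex u y)" "continuous_on A (\<lambda>y. Complex u y)" for A u y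
    unfolding Complex_eq by (intro continuous_intros)+
  have cosT: "cos (\<omega> * T) = 0" "cos (\<omega> * (- T)) = 0"
  proof -
    have "\<omega> * T = real m * pi + pi / 2" using h by (simp add: \<omega>_def T_def field_simps)
    then show "cos (\<omega> * T) = 0" by (simp add: cos_add)
    then show "cos (\<omega> * (- T)) = 0" by simp
  qed
  let ?K = "\<lambda>t w. F w * sin (of_real (\<omega> * t)) / ((w - of_real t) * sin (of_real \<omega> * w))"
  let ?H = "C * (2 / b) / sinh (\<omega> * e) * ((1 + pi) / (\<omega> * e))"
  let ?V = "2 * e * (C * (cosh T * exp (- b * sinh T)) * (x - a))"
  have sinhe: "0 < sinh (\<omega> * e)" using \<omega> e by simp
  have horiz: "(\<lambda>t. integral {-T..T} (\<lambda>u. ?K t (Complex u y))) integrable_on {a..x}"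
    "norm (integral {a..x} (\<lambda>t. integral {-T..T} (\<lambda>u. ?K t (Complex u y)))) \<le> ?H"
    if y: "\<bar>y\<bar> = e" for y
  proof -
    let ?B = "\<lambda>u. C * (1 + pi) / (sinh (\<omega> * e) * (\<omega> * e)) * (cosh u * exp (- b * \<bar>sinh u\<bar>))"
    have sn: "sinh (\<omega> * e) \<le> norm (sin (of_real \<omega> * Complex u y))" for u
      using sinh_abs_Im_le_norm_sin[of "of_real \<omega> * Complex u y"] y \<omega> by (simp add: abs_mult)
    have Bi: "?B integrable_on {-T..T}"
      using cosh_exp_abs_sinh_integral(1)[OF b, of T] T by (intro integrable_on_mult_right) auto
    have bd: "norm (F (Complex u y) / sin (of_real \<omega> * Complex u y))
          * norm (integral {a..x} (\<lambda>t. sin (complex_of_real (\<omega> * t)) / (Complex u y - of_real t))) \<le> ?B u" for u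
    proof -
      have "norm (F (Complex u y) / sin (of_real \<omega> * Complex u y)) \<le> C * (cosh u * exp (- b * \<bar>sinh u\<bar>)) / sinh (\<omega> * e)"
        unfolding norm_divide using bound[of y u] y sn[of u] sinhe C by (intro frac_le) auto
      moreover have "norm (integral {a..x} (\<lambda>t. sin (complex_of_real (\<omega> * t)) / (Complex u y - of_real t))) \<le> (1 + pi) / (\<omega> * e)"
        using norm_integral_sin_kernel_le[OF \<omega>, of a x "Complex u y"] ax a y e by (simp add: \<omega>_def)
      ultimately have "norm (F (Complex u y) / sin (of_real \<omega> * Complex u y))
          * norm (integral {a..x} (\<lambda>t. sin (complex_of_real (\<omega> * t)) / (Complex u y - of_real t)))
          \<le> C * (cosh u * exp (- b * \<bar>sinh u\<bar>)) / sinh (\<omega> * e) * ((1 + pi) / (\<omega> * e))"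
        using C sinhe by (intro mult_mono) auto
      then show ?thesis by (simp add: field_simps)
    qed
    have nz: "sin (of_real \<omega> * Complex u y) \<noteq> 0" for u using sn[of u] sinhe by auto
    have off: "Complex u y \<noteq> of_real t" for u t using y e by (auto simp: complex_eq_iff)
    have sub: "(\<lambda>u. Complex u y) ` {-T..T} \<subseteq> strip d" using y stripI by auto
    note R = norm_integral_kernel_path_le[OF contF cC(1) sub nz off Bi bd]
    show "(\<lambda>t. integral {-T..T} (\<lambda>u. ?K t (Complex u y))) integrable_on {a..x}" by (rule R(1))
    have "integral {-T..T} ?B = C * (1 + pi) / (sinh (\<omega> * e) * (\<omega> * e)) * integral {-T..T} (\<lambda>u. cosh u * exp (- b * \<bar>sinh u\<bar>))"
      by (rule integral_mult_right)
    also have "\<dots> \<le> C * (1 + pi) / (sinh (\<omega> * e) * (\<omega> * e)) * (2 / b)"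
      using cosh_exp_abs_sinh_integral(2)[OF b, of T] T C sinhe \<omega> e by (intro mult_left_mono) auto
    also have "\<dots> = ?H" by (simp add: mult_ac)
    finally show "norm (integral {a..x} (\<lambda>t. integral {-T..T} (\<lambda>u. ?K t (Complex u y)))) \<le> ?H"
      using R(2) by linarith
  qed
  have vert: "(\<lambda>t. integral {-e..e} (\<lambda>y. ?K t (Complex u y))) integrable_on {a..x}"
    "norm (integral {a..x} (\<lambda>t. integral {-e..e} (\<lambda>y. ?K t (Complex u y)))) \<le> ?V"
    if u: "\<bar>u\<bar> = T" for u
  proof -
    let ?c = "C * (cosh T * exp (- b * sinh T)) * (x - a)"
    have cu: "cosh u = cosh T" "\<bar>sinh u\<bar> = sinh T" using u T by (auto simp: abs_if split: if_splits)
    have "cos (\<omega> * u) = 0" using u cosT by (auto simp: abs_if split: if_splits)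
    then have sn: "1 \<le> norm (sin (of_real \<omega> * Complex u y))" for y
      by (intro one_le_norm_sin) simp
    \<comment> \<open>The margin 1 in \<open>aT\<close> and \<open>xT\<close> keeps the vertical
      sides at distance at least 1 from [a, x].\<close>
    have far: "1 \<le> norm (Complex u y - of_real t)" if "t \<in> {a..x}" for y t
    proof -
      have "1 \<le> \<bar>u - t\<bar>" using that u aT xT by auto
      also have "\<dots> \<le> norm (Complex u y - of_real t)" using abs_Re_le_cmod[of "Complex u y - of_real t"] by simp
      finally show ?thesis .
    qed
    have bd: "norm (F (Complex u y) / sin (of_real \<omega> * Complex u y))
          * norm (integral {a..x} (\<lambda>t. sin (complex_of_real (\<omega> * t)) / (Complex u y - of_real t))) \<le> ?c" if y: "y \<in> {-e..e}" for y
    proof -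
      have "norm (F (Complex u y) / sin (of_real \<omega> * Complex u y)) \<le> C * (cosh T * exp (- b * sinh T)) / 1"
        unfolding norm_divide using bound[of y u] y sn[of y] C cu by (intro frac_le) auto
      moreover have "norm (integral {a..x} (\<lambda>t. sin (complex_of_real (\<omega> * t)) / (Complex u y - of_real t))) \<le> 1 * (x - a)"
      proof (rule integral_bound)
        show "a \<le> x" using ax by simp
        show "continuous_on {a..x} (\<lambda>t. sin (complex_of_real (\<omega> * t)) / (Complex u y - of_real t))"
          using far[of _ y] by (intro continuous_intros) fastforce
        fix t assume t: "t \<in> {a..x}"
        have "norm (sin (complex_of_real (\<omega> * t)) / (Complex u y - of_real t)) \<le> 1 / 1"
          unfolding norm_divide using far[OF t, of y]
          by (intro frac_le) (auto simp: sin_of_real simp del: of_real_mult)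
        then show "norm (sin (complex_of_real (\<omega> * t)) / (Complex u y - of_real t)) \<le> 1" by simp
      qed
      ultimately have "norm (F (Complex u y) / sin (of_real \<omega> * Complex u y))
          * norm (integral {a..x} (\<lambda>t. sin (complex_of_real (\<omega> * t)) / (Complex u y - of_real t)))
          \<le> C * (cosh T * exp (- b * sinh T)) / 1 * (1 * (x - a))"
        using C by (intro mult_mono) auto
      then show ?thesis by simp
    qed
    have nz: "sin (of_real \<omega> * Complex u y) \<noteq> 0" for y using sn[of y] by auto
    have off: "Complex u y \<noteq> of_real t" if "t \<in> {a..x}" for y t using far[OF that, of y] by auto
    have sub: "(\<lambda>y. Complex u y) ` {-e..e} \<subseteq> strip d" using stripI by auto
    have ci: "(\<lambda>y. ?c) integrable_on {-e..e}" by (rule integrable_const_ivl)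
    note R = norm_integral_kernel_path_le[OF contF cC(2) sub nz off ci bd]
    show "(\<lambda>t. integral {-e..e} (\<lambda>y. ?K t (Complex u y))) integrable_on {a..x}" by (rule R(1)) auto
    have "norm (integral {a..x} (\<lambda>t. integral {-e..e} (\<lambda>y. ?K t (Complex u y)))) \<le> integral {-e..e} (\<lambda>y. ?c)"
      by (rule R(2)) auto
    also have "\<dots> = ?V" using e by simp
    finally show "norm (integral {a..x} (\<lambda>t. integral {-e..e} (\<lambda>y. ?K t (Complex u y)))) \<le> ?V" .
  qed
  let ?E = "\<lambda>t. F (of_real t) - (\<Sum>k\<in>{- int m..int m}. F (of_real (k * h)) * of_real (sinc (pi * (t / h - k))))"
  let ?I1 = "\<lambda>t. integral {-T..T} (\<lambda>u. ?K t (Complex u (- e)))" and ?I3 = "\<lambda>t. integral {-T..T} (\<lambda>u. ?K t (Complex u e))"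
  let ?I2 = "\<lambda>t. integral {-e..e} (\<lambda>y. ?K t (Complex T y))" and ?I4 = "\<lambda>t. integral {-e..e} (\<lambda>y. ?K t (Complex (- T) y))"
  have Ieq: "2 * pi * \<i> * ?E t = ?I1 t + \<i> * ?I2 t - ?I3 t - \<i> * ?I4 t" if t: "t \<in> {a..x}" for t
  proof -
    have tT: "\<bar>t\<bar> < T" using t aT xT by auto
    have "continuous_on (path_image (rectpath (Complex (- T) (- e)) (Complex T e))) (?K t)"
    proof (intro continuous_intros continuous_on_subset[OF contF])
      have P: "path_image (rectpath (Complex (- T) (- e)) (Complex T e)) =
           {z. Re z \<in> {- T, T} \<and> Im z \<in> {- e..e}} \<union> {z. Im z \<in> {- e, e} \<and> Re z \<in> {- T..T}}"
        using T e by (subst path_image_rectpath) auto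
      show "path_image (rectpath (Complex (- T) (- e)) (Complex T e)) \<subseteq> strip d"
        unfolding P using e by (auto simp: strip_def)
      show "\<forall>z\<in>path_image (rectpath (Complex (- T) (- e)) (Complex T e)). (z - of_real t) * sin (of_real \<omega> * z) \<noteq> 0"
      proof
        fix z assume z: "z \<in> path_image (rectpath (Complex (- T) (- e)) (Complex T e))"
        then have "z \<noteq> of_real t" unfolding P using tT e by auto
        moreover have "sin (of_real \<omega> * z) \<noteq> 0"
        proof (cases "Re z \<in> {- T, T}")
          case True
          then have "cos (Re (of_real \<omega> * z)) = 0" using cosT by auto
          then show ?thesis using one_le_norm_sin[of "of_real \<omega> * z"] by auto
        next
          case False
          then have "\<bar>Im z\<bar> = e" using z e unfolding P by auto
          then have "\<bar>Im (of_real \<omega> * z)\<bar> = \<omega> * e" using \<omega> by (simp add: abs_mult)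
          then show ?thesis using sinh_abs_Im_le_norm_sin[of "of_real \<omega> * z"] sinhe by auto
        qed
        ultimately show "(z - of_real t) * sin (of_real \<omega> * z) \<noteq> 0" by simp
      qed
    qed
    from contour_integral_rectpath[OF _ _ this] T e
    have "contour_integral (rectpath (Complex (- T) (- e)) (Complex T e)) (?K t) = ?I1 t + \<i> * ?I2 t - ?I3 t - \<i> * ?I4 t"
      by simp
    with sinc_interpolation_rectpath[OF h F e, of t m] tT show ?thesis
      by (simp only: T_def \<omega>_def)
  qed
  define E where "E = ?E"
  define I1 where "I1 = ?I1"
  define I2 where "I2 = ?I2"
  define I3 where "I3 = ?I3"
  define I4 where "I4 = ?I4"
  have Ieq': "2 * pi * \<i> * E t = I1 t + \<i> * I2 t - I3 t - \<i> * I4 t" if t: "t \<in> {a..x}" for t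
    unfolding E_def I1_def I2_def I3_def I4_def by (rule Ieq[OF t])
  have int: "I1 integrable_on {a..x}" "I2 integrable_on {a..x}" "I3 integrable_on {a..x}" "I4 integrable_on {a..x}"
    unfolding I1_def I2_def I3_def I4_def using e T by (intro horiz(1) vert(1); simp)+
  have le: "norm (integral {a..x} I1) \<le> ?H" "norm (integral {a..x} I2) \<le> ?V"
    "norm (integral {a..x} I3) \<le> ?H" "norm (integral {a..x} I4) \<le> ?V"
    unfolding I1_def I2_def I3_def I4_def using e T by (intro horiz(2) vert(2); simp)+
  have "2 * pi * norm (integral {a..x} E) = norm (integral {a..x} (\<lambda>t. 2 * pi * \<i> * E t))"
    by (simp add: norm_mult)
  also have "integral {a..x} (\<lambda>t. 2 * pi * \<i> * E t) = integral {a..x} (\<lambda>t. I1 t + \<i> * I2 t - I3 t - \<i> * I4 t)"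
    by (rule integral_cong) (rule Ieq')
  also have "norm \<dots> \<le> norm (integral {a..x} I1) + norm (integral {a..x} I2)
      + norm (integral {a..x} I3) + norm (integral {a..x} I4)"
    by (rule norm_integral_four_sides_le[OF int])
  finally have "2 * pi * norm (integral {a..x} E) \<le> 2 * ?H + 2 * ?V"
    using le by linarith
  then have 1: "norm (integral {a..x} E) \<le> (2 * ?H + 2 * ?V) / (2 * pi)"
    by (simp add: pos_le_divide_eq mult.commute)
  have sinc_int: "((\<lambda>t. sinc (pi * (t / h - k))) has_integral (Jfun k h x - Jfun k h a)) {a..x}" for k :: int
  proof (rule fundamental_theorem_of_calculus)
    show "a \<le> x" using ax by simp
    show "(Jfun k h has_vector_derivative sinc (pi * (t / h - k))) (at t within {a..x})" for t
      unfolding has_real_derivative_iff_has_vector_derivative[symmetric]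
      by (rule has_field_derivative_at_within[OF Jfun_has_real_derivative[OF h]])
  qed
  have "((\<lambda>t. \<Sum>k\<in>{- int m..int m}. F (of_real (k * h)) * of_real (sinc (pi * (t / h - k))))
      has_integral (\<Sum>k\<in>{- int m..int m}. F (of_real (k * h)) * of_real (Jfun k h x - Jfun k h a))) {a..x}"
    by (intro has_integral_sum has_integral_mult_right has_integral_of_real sinc_int) simp
  moreover have "(\<lambda>t. F (of_real t)) integrable_on {a..x}"
    using e by (intro integrable_continuous_interval continuous_on_compose2[OF contF] continuous_intros)
       (auto simp: strip_def)
  ultimately have "integral {a..x} E = integral {a..x} (\<lambda>t. F (of_real t))
      - (\<Sum>k\<in>{- int m..int m}. F (of_real (k * h)) * of_real (Jfun k h x - Jfun k h a))"
    unfolding E_def by (subst integral_diff) (auto simp: has_integral_iff)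
  with 1 show ?thesis by (simp only: \<omega>_def)
qed

section \<open>Truncation of the series and the limits in the auxiliary parameters\<close>

text \<open>Indices above N decay at rate p, and those below -M at rate q after the reflection of k
  to -k. The bound depends neither on m nor on x, as the later limits require.\<close>

lemma sum_outside_le:
  fixes F :: "complex \<Rightarrow> complex" and A p q h :: real and M N :: int
  assumes h: "0 < h" and A: "0 \<le> A" and p: "0 < p" and q: "0 < q"
    and Fp: "\<And>u. norm (F (of_real u)) \<le> A * (cosh u * exp (- p * sinh u))"
    and Fq: "\<And>u. norm (F (of_real u)) \<le> A * (cosh u * exp (q * sinh u))"
    and N: "0 \<le> N" "1 \<le> 2 * p * sinh (N * h)" and M: "0 \<le> M" "1 \<le> 2 * q * sinh (M * h)"
  shows "norm (\<Sum>k\<in>{- int m..int m} - {-M..N}. F (of_real (k * h)) * of_real (Jfun k h x))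
    \<le> (1 + 2 / pi) * A * sqrt 2 * (exp (- p * sinh (N * h)) / p + exp (- q * sinh (M * h)) / q)"
proof -
  let ?c = "(1 + 2 / pi) * A"
  let ?g = "\<lambda>(r::real) (k::int). h * (cosh (k * h) * exp (- r * sinh (k * h)))"
  have c: "0 \<le> ?c" using A by simp
  have termp: "norm (F (of_real (k * h)) * of_real (Jfun k h x)) \<le> ?c * ?g p k" for k :: int
  proof -
    have "norm (F (of_real (k * h))) * \<bar>Jfun k h x\<bar> \<le> A * (cosh (k * h) * exp (- p * sinh (k * h))) * ((1 + 2 / pi) * h)"
      using Fp[of "k * h"] abs_Jfun_le[OF h, of k x] A by (intro mult_mono) auto
    then show ?thesis by (simp add: norm_mult mult_ac)
  qed
  have termq: "norm (F (of_real (k * h)) * of_real (Jfun k h x)) \<le> ?c * ?g q (- k)" for k :: int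
  proof -
    have "norm (F (of_real (k * h))) * \<bar>Jfun k h x\<bar> \<le> A * (cosh (k * h) * exp (q * sinh (k * h))) * ((1 + 2 / pi) * h)"
      using Fq[of "k * h"] abs_Jfun_le[OF h, of k x] A by (intro mult_mono) auto
    then show ?thesis by (simp add: norm_mult mult_ac)
  qed
  let ?P = "{N<..N + int m}" and ?Q = "{M<..M + int m}"
  let ?t = "\<lambda>k. norm (F (of_real (real_of_int k * h)) * of_real (Jfun k h x))"
  have "norm (\<Sum>k\<in>{- int m..int m} - {-M..N}. F (of_real (k * h)) * of_real (Jfun k h x)) \<le> sum ?t ({- int m..int m} - {-M..N})"
    by (rule norm_sum)
  also have "\<dots> \<le> sum ?t (?P \<union> uminus ` ?Q)"
  proof (rule sum_mono2)
    show "{- int m..int m} - {-M..N} \<subseteq> ?P \<union> uminus ` ?Q"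
    proof
      fix k assume k: "k \<in> {- int m..int m} - {-M..N}"
      show "k \<in> ?P \<union> uminus ` ?Q"
      proof (cases "N < k")
        case False
        then have "- k \<in> ?Q" using k M by auto
        then show ?thesis by (auto intro!: image_eqI[of _ _ "- k"])
      qed (use k N in auto)
    qed
  qed auto
  also have "\<dots> = sum ?t ?P + sum ?t (uminus ` ?Q)"
    using M N by (intro sum.union_disjoint) auto
  also have "sum ?t (uminus ` ?Q) = (\<Sum>k\<in>?Q. ?t (- k))"
    by (subst sum.reindex) auto
  also have "sum ?t ?P + (\<Sum>k\<in>?Q. ?t (- k)) \<le> (\<Sum>k\<in>?P. ?c * ?g p k) + (\<Sum>k\<in>?Q. ?c * ?g q (- (- k)))"
    by (intro add_mono sum_mono termp termq)
  also have "\<dots> = ?c * ((\<Sum>k\<in>?P. ?g p k) + (\<Sum>k\<in>?Q. ?g q k))"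
    by (simp add: sum_distrib_left distrib_left)
  also have "\<dots> \<le> ?c * (sqrt 2 / p * exp (- p * sinh (N * h)) + sqrt 2 / q * exp (- q * sinh (M * h)))"
    using sum_cosh_exp_sinh_le[OF p h N(2), of m] sum_cosh_exp_sinh_le[OF q h M(2), of m] c
    by (intro mult_left_mono add_mono)
  also have "\<dots> = ?c * sqrt 2 * (exp (- p * sinh (N * h)) / p + exp (- q * sinh (M * h)) / q)"
    by (simp add: distrib_left)
  finally show ?thesis .
qed

text \<open>cosh x \<le> 1 + sinh x for x \<ge> 0, and the substitution s = sinh x leaves (1 + s)
  e^(-bs).\<close>

lemma tendsto_cosh_exp_sinh_zero:
  fixes b :: real
  assumes "0 < b"
  shows "((\<lambda>x. cosh x * exp (- b * sinh x)) \<longlongrightarrow> 0) at_top"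
proof -
  have lim: "((\<lambda>x. (1 + sinh x) * exp (- b * sinh x)) \<longlongrightarrow> 0) at_top"
  proof (rule filterlim_compose[OF _ sinh_real_at_top])
    show "((\<lambda>s. (1 + s) * exp (- b * s)) \<longlongrightarrow> 0) at_top"
      using assms by real_asymp
  qed
  show ?thesis
  proof (rule tendsto_sandwich[OF _ _ tendsto_const lim])
    show "\<forall>\<^sub>F x in at_top. cosh x * exp (- b * sinh x) \<le> (1 + sinh x) * exp (- b * sinh x)"
      using eventually_ge_at_top[of 0]
    proof eventually_elim
      case (elim x)
      have "(cosh x)\<^sup>2 \<le> (1 + sinh x)\<^sup>2"
        unfolding cosh_square_eq power2_sum using elim by simp
      then have "cosh x \<le> 1 + sinh x"
        by (rule power2_le_imp_le) (use elim in \<open>simp add: add_nonneg_nonneg\<close>)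
      then show ?case by (intro mult_right_mono) auto
    qed
  qed auto
qed

text \<open>Bookkeeping: \<open>S\<close> and \<open>U\<close> are the kept and discarded terms at
  the upper limit of integration, \<open>V\<close> and \<open>W\<close> those at the lower limit.
  The norm of \<open>V\<close> is retained because it will tend to 0.\<close>

lemma norm_diff_le_of_split:
  fixes I S U V W X :: complex
  assumes X: "X = (S + U) - (V + W)" and "norm (I - X) \<le> r1" "norm U \<le> r2" "norm W \<le> r3"
  shows "norm (I - S) \<le> r1 + r2 + r3 + norm V"
proof -
  have "I - S = (I - X) + U - V - W" by (simp add: X)
  also have "norm \<dots> \<le> norm (I - X) + norm U + norm V + norm W"
    by (meson add_right_mono norm_triangle_ineq norm_triangle_ineq4 order_trans)
  finally show ?thesis using assms by linarith
qed

text \<open>Three limits in a fixed order. First m grows, which removes the vertical sides. Then the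
  lower limit a tends to minus infinity: the finitely many terms with |k| \<le> n vanish, while the
  others are bounded uniformly in a. Finally n grows, which removes that last remainder.\<close>

lemma sinc_indefinite_error:
  fixes F :: "complex \<Rightarrow> complex" and h d e x b C A p q :: real and M N :: int
  assumes h: "0 < h" and F: "F holomorphic_on strip d" and e: "0 < e" "e < d"
    and b: "0 < b" and C: "0 \<le> C"
    and bound: "\<And>u y. \<bar>y\<bar> \<le> e \<Longrightarrow> norm (F (Complex u y)) \<le> C * (cosh u * exp (- b * \<bar>sinh u\<bar>))"
    and A: "0 \<le> A" and p: "0 < p" and q: "0 < q"
    and Fp: "\<And>u. norm (F (of_real u)) \<le> A * (cosh u * exp (- p * sinh u))"
    and Fq: "\<And>u. norm (F (of_real u)) \<le> A * (cosh u * exp (q * sinh u))"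
    and N: "0 \<le> N" "1 \<le> 2 * p * sinh (N * h)" and M: "0 \<le> M" "1 \<le> 2 * q * sinh (M * h)"
    and L: "((\<lambda>a. integral {a..x} (\<lambda>t. F (of_real t))) \<longlongrightarrow> L) at_bot"
  shows "norm (L - (\<Sum>k\<in>{-M..N}. F (of_real (k * h)) * of_real (Jfun k h x)))
    \<le> 2 * (C * (2 / b) / sinh (pi / h * e) * ((1 + pi) / (pi / h * e))) / (2 * pi)
      + (1 + 2 / pi) * A * sqrt 2 * (exp (- p * sinh (N * h)) / p + exp (- q * sinh (M * h)) / q)"
    (is "norm (L - ?S) \<le> ?R + ?tail N M")
proof -
  \<comment> \<open>Half-integer multiples of h, so that the boundary term at the lower limit
    vanishes in the kernel estimate.\<close>
  define a where "a j = - ((real j + 1/2) * h)" for j :: nat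
  define T where "T m = (real m + 1/2) * h" for m :: nat
  have T_top: "filterlim T at_top sequentially"
    unfolding T_def using h by (intro filterlim_at_top_mult_tendsto_pos[OF tendsto_const])
      (auto intro!: filterlim_tendsto_add_at_top[OF tendsto_const filterlim_real_sequentially] simp: add.commute[of _ "1/2"])
  have a_bot: "filterlim a at_bot sequentially"
    using T_top by (simp add: a_def[abs_def] T_def[abs_def] filterlim_uminus_at_top)
  have a_zero: "cos (pi / h * a j) = 0" for j
  proof -
    have "pi / h * a j = - (real j * pi + pi / 2)" using h by (simp add: a_def field_simps)
    then show ?thesis by (simp only: cos_minus cos_add) simp
  qed
  have fin: "norm (integral {a j..x} (\<lambda>t. F (of_real t)) - ?S)
      \<le> ?R + ?tail N M + ?tail n n + norm (\<Sum>k\<in>{-n..n}. F (of_real (k * h)) * of_real (Jfun k h (a j)))"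
    if j: "a j < x" and n: "0 \<le> n" "1 \<le> 2 * p * sinh (n * h)" "1 \<le> 2 * q * sinh (n * h)" for j and n :: int
  proof -
    let ?I = "integral {a j..x} (\<lambda>t. F (of_real t))"
    let ?Sn = "\<Sum>k\<in>{-n..n}. F (of_real (k * h)) * of_real (Jfun k h (a j))"
    let ?V = "\<lambda>m. 2 * (2 * e * (C * (cosh (T m) * exp (- b * sinh (T m))) * (x - a j))) / (2 * pi)"
    have "((\<lambda>m. cosh (T m) * exp (- b * sinh (T m))) \<longlongrightarrow> 0) sequentially"
      by (rule filterlim_compose[OF tendsto_cosh_exp_sinh_zero[OF b] T_top])
    then have "(\<lambda>m. 2 * (2 * e * (C * (cosh (T m) * exp (- b * sinh (T m))) * (x - a j))) / (2 * pi))
        \<longlonglongrightarrow> 2 * (2 * e * (C * 0 * (x - a j))) / (2 * pi)"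
      by (intro tendsto_intros) auto
    then have "?V \<longlonglongrightarrow> 0" by simp
    then have lim: "(\<lambda>m. ?R + ?V m + ?tail N M + ?tail n n + norm ?Sn)
        \<longlonglongrightarrow> ?R + 0 + ?tail N M + ?tail n n + norm ?Sn"
      by (intro tendsto_add tendsto_const)
    have "\<forall>\<^sub>F m in sequentially. norm (?I - ?S) \<le> ?R + ?V m + ?tail N M + ?tail n n + norm ?Sn"
    proof -
      have "\<forall>\<^sub>F m in sequentially. \<bar>a j\<bar> + 1 \<le> T m" "\<forall>\<^sub>F m in sequentially. \<bar>x\<bar> + 1 \<le> T m"
        using T_top unfolding filterlim_at_top by blast+
      moreover have "\<forall>\<^sub>F m in sequentially. nat (max n (max M N)) \<le> m" by (rule eventually_ge_at_top)
      ultimately show ?thesis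
      proof eventually_elim
        case (elim m)
        let ?B = "{- int m..int m}"
        let ?f = "\<lambda>y k. F (of_real (real_of_int k * h)) * of_real (Jfun k h y)"
        have sub: "{-M..N} \<subseteq> ?B" "{-n..n} \<subseteq> ?B" using elim(3) by auto
        have 1: "norm (?I - (\<Sum>k\<in>?B. F (of_real (k * h)) * of_real (Jfun k h x - Jfun k h (a j)))) \<le> ?R + ?V m"
          unfolding T_def add_divide_distrib[symmetric]
          by (rule sinc_indefinite_error_rectpath[OF h F e j a_zero _ _ b C bound])
             (use elim(1,2) in \<open>simp_all only: T_def\<close>)
        have s1: "sum (?f x) ?B = ?S + sum (?f x) (?B - {-M..N})"
          by (subst sum.subset_diff[OF sub(1)]) (simp_all only: finite_atLeastAtMost_int add.commute)
        have s2: "sum (?f (a j)) ?B = ?Sn + sum (?f (a j)) (?B - {-n..n})"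
          by (subst sum.subset_diff[OF sub(2)]) (simp_all only: finite_atLeastAtMost_int add.commute)
        have t1: "norm (sum (?f x) (?B - {-M..N})) \<le> ?tail N M"
          by (rule sum_outside_le[where F = F, OF h A p q Fp Fq N M])
        have t2: "norm (sum (?f (a j)) (?B - {-n..n})) \<le> ?tail n n"
          by (rule sum_outside_le[where F = F, OF h A p q Fp Fq n(1,2) n(1,3)])
        have eq: "(\<Sum>k\<in>?B. F (of_real (k * h)) * of_real (Jfun k h x - Jfun k h (a j)))
            = (?S + sum (?f x) (?B - {-M..N})) - (?Sn + sum (?f (a j)) (?B - {-n..n}))"
          unfolding s1[symmetric] s2[symmetric] sum_subtractf[symmetric]
          by (rule sum.cong[OF refl]) (simp only: of_real_diff right_diff_distrib)
        have "norm (?I - ?S) \<le> (?R + ?V m) + ?tail N M + ?tail n n + norm ?Sn"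
          by (rule norm_diff_le_of_split[OF eq 1 t1 t2])
        then show ?case .
      qed
    qed
    from tendsto_lowerbound[OF lim this sequentially_bot] show ?thesis by (simp only: add_0_right)
  qed
  have step: "norm (L - ?S) \<le> ?R + ?tail N M + ?tail n n"
    if n: "0 \<le> n" "1 \<le> 2 * p * sinh (n * h)" "1 \<le> 2 * q * sinh (n * h)" for n :: int
  proof -
    have "(\<lambda>j. \<Sum>k\<in>{-n..n}. F (of_real (k * h)) * of_real (Jfun k h (a j)))
        \<longlonglongrightarrow> (\<Sum>k\<in>{-n..n}. F (of_real (k * h)) * of_real 0)"
      unfolding a_def by (intro tendsto_intros tendsto_Jfun_zero h)
    then have S0: "(\<lambda>j. norm (\<Sum>k\<in>{-n..n}. F (of_real (k * h)) * of_real (Jfun k h (a j)))) \<longlonglongrightarrow> 0"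
      by (simp add: tendsto_norm_zero)
    have lim: "(\<lambda>j. norm (integral {a j..x} (\<lambda>t. F (of_real t)) - ?S)) \<longlonglongrightarrow> norm (L - ?S)"
      by (intro tendsto_intros filterlim_compose[OF L a_bot])
    have lim': "(\<lambda>j. ?R + ?tail N M + ?tail n n + norm (\<Sum>k\<in>{-n..n}. F (of_real (k * h)) * of_real (Jfun k h (a j))))
        \<longlonglongrightarrow> ?R + ?tail N M + ?tail n n + 0"
      by (intro tendsto_add tendsto_const S0)
    have "\<forall>\<^sub>F j in sequentially. a j < x"
      using a_bot unfolding filterlim_at_bot_dense by blast
    then have "\<forall>\<^sub>F j in sequentially. norm (integral {a j..x} (\<lambda>t. F (of_real t)) - ?S)
      \<le> ?R + ?tail N M + ?tail n n + norm (\<Sum>k\<in>{-n..n}. F (of_real (k * h)) * of_real (Jfun k h (a j)))"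
      by eventually_elim (rule fin[OF _ n])
    from tendsto_le[OF sequentially_bot lim' lim this] show ?thesis by (simp only: add_0_right)
  qed
  have sn: "filterlim (\<lambda>n::nat. sinh (real n * h)) at_top sequentially"
    using h by (intro filterlim_compose[OF sinh_real_at_top] filterlim_at_top_mult_tendsto_pos[OF tendsto_const]
        filterlim_real_sequentially)
  have ez: "(\<lambda>n::nat. exp (- r * sinh (real n * h))) \<longlonglongrightarrow> 0" if "0 < r" for r
  proof -
    have "filterlim (\<lambda>n::nat. r * sinh (real n * h)) at_top sequentially"
      by (rule filterlim_tendsto_pos_mult_at_top[OF tendsto_const that sn])
    then have "filterlim (\<lambda>n::nat. - r * sinh (real n * h)) at_bot sequentially"
      by (simp add: filterlim_uminus_at_top)
    then show ?thesis by (rule filterlim_compose[OF exp_at_bot])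
  qed
  have "(\<lambda>n::nat. (1 + 2 / pi) * A * sqrt 2 * (exp (- p * sinh (real n * h)) / p + exp (- q * sinh (real n * h)) / q))
      \<longlonglongrightarrow> (1 + 2 / pi) * A * sqrt 2 * (0 / p + 0 / q)"
    using p q by (intro tendsto_intros ez) auto
  then have lim: "(\<lambda>n::nat. ?R + ?tail N M + ?tail (int n) (int n)) \<longlonglongrightarrow> ?R + ?tail N M + 0"
    by (intro tendsto_add tendsto_const) simp
  have "\<forall>\<^sub>F n::nat in sequentially. norm (L - ?S) \<le> ?R + ?tail N M + ?tail (int n) (int n)"
  proof -
    have "\<forall>\<^sub>F n::nat in sequentially. 1 / (2 * p) \<le> sinh (real n * h)"
         "\<forall>\<^sub>F n::nat in sequentially. 1 / (2 * q) \<le> sinh (real n * h)"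
      using sn unfolding filterlim_at_top by blast+
    then show ?thesis
    proof eventually_elim
      case (elim n)
      have "1 \<le> sinh (real n * h) * (2 * p)" "1 \<le> sinh (real n * h) * (2 * q)"
        using elim p q by (simp_all only: pos_divide_le_eq mult_pos_pos zero_less_numeral)
      then have "1 \<le> 2 * p * sinh (real_of_int (int n) * h)" "1 \<le> 2 * q * sinh (real_of_int (int n) * h)"
        by (simp_all only: of_int_of_nat_eq mult.commute)
      then show ?case by (rule step[rotated]) simp
    qed
  qed
  from tendsto_lowerbound[OF lim this sequentially_bot] show ?thesis by (simp only: add_0_right)
qed

section \<open>The transformed integrand\<close>

text \<open>The function \<open>F\<close> of the outline; the factor in parentheses is the
  derivative of \<open>psiC\<close>.\<close>

definition de_integrand :: "(complex \<Rightarrow> complex) \<Rightarrow> complex \<Rightarrow> complex" where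
  "de_integrand f \<zeta> = f (psiC \<zeta>) * (of_real (pi/2) * cosh \<zeta> * psiC \<zeta>)"

lemma Re_sinh_Complex: "Re (sinh (Complex x y)) = sinh x * cos y"
  and Im_sinh_Complex: "Im (sinh (Complex x y)) = cosh x * sin y"
  by (simp_all add: sinh_def cosh_def Re_exp Im_exp algebra_simps)

lemma norm_cosh_Complex_le: "norm (cosh (Complex x y)) \<le> cosh x"
proof -
  have "norm (cosh (Complex x y)) \<le> (norm (exp (Complex x y)) + norm (exp (- Complex x y))) / 2"
    unfolding cosh_def using norm_triangle_ineq[of "exp (Complex x y)" "exp (- Complex x y)"] by simp
  also have "\<dots> = cosh x" by (simp add: cosh_def)
  finally show ?thesis .
qed

lemma norm_psiC: "norm (psiC (Complex x y)) = exp (pi * (sinh x * cos y) / 2)"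
  by (simp add: psiC_def Re_sinh_Complex)

text \<open>For z = \<open>psiC \<zeta>\<close> this writes 1 + z^2 as 1 + e^(p+iq), the form in
  which its modulus was bounded below.\<close>

lemma psiC_square: "(psiC (Complex x y))\<^sup>2 = exp (Complex (pi * (sinh x * cos y)) (pi * (cosh x * sin y)))"
proof -
  have "2 * (of_real (pi/2) * sinh (Complex x y)) = Complex (pi * (sinh x * cos y)) (pi * (cosh x * sin y))"
    by (simp add: complex_eq_iff Re_sinh_Complex Im_sinh_Complex)
  then show ?thesis by (simp only: psiC_def flip: exp_double)
qed

lemma cos_half_pi_sin_pos:
  assumes "\<bar>y\<bar> < pi/2"
  shows "0 < cos (pi/2 * sin y)"
proof -
  have "0 < cos y" using assms by (intro cos_gt_zero_pi) auto
  then have "(sin y)\<^sup>2 < 1" using sin_squared_eq[of y] by simp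
  then have "\<bar>sin y\<bar> < 1" by (simp add: abs_square_less_1)
  then have "pi/2 * \<bar>sin y\<bar> < pi/2 * 1" by (intro mult_strict_left_mono) auto
  then have "\<bar>pi/2 * sin y\<bar> < pi/2" by (simp add: abs_mult)
  then show ?thesis by (intro cos_gt_zero_pi) linarith+
qed

section \<open>Decay of the transformed integrand\<close>

text \<open>The denominator is at least 1 and at least e^(p(\<alpha>+\<beta>)/2). The first bound is
  the sharp one for negative p, the second for positive p.\<close>

lemma exp_div_powr_le:
  fixes p \<alpha> \<beta> :: real
  assumes "0 < \<alpha>" "0 < \<beta>"
  shows "exp (\<alpha> * p / 2) / (1 + exp p) powr ((\<alpha> + \<beta>) / 2) \<le> exp (\<alpha> * p / 2)"
    and "exp (\<alpha> * p / 2) / (1 + exp p) powr ((\<alpha> + \<beta>) / 2) \<le> exp (- \<beta> * p / 2)"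
proof -
  have "1 \<le> (1 + exp p) powr ((\<alpha> + \<beta>) / 2)" using assms by (intro ge_one_powr_ge_zero) auto
  then have "exp (\<alpha> * p / 2) / (1 + exp p) powr ((\<alpha> + \<beta>) / 2) \<le> exp (\<alpha> * p / 2) / 1"
    by (intro frac_le) auto
  then show "exp (\<alpha> * p / 2) / (1 + exp p) powr ((\<alpha> + \<beta>) / 2) \<le> exp (\<alpha> * p / 2)" by simp
  have "exp p powr ((\<alpha> + \<beta>) / 2) \<le> (1 + exp p) powr ((\<alpha> + \<beta>) / 2)"
    using assms by (intro powr_mono2) auto
  then have "exp (\<alpha> * p / 2) / (1 + exp p) powr ((\<alpha> + \<beta>) / 2) \<le> exp (\<alpha> * p / 2) / exp p powr ((\<alpha> + \<beta>) / 2)"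
    by (intro frac_le) auto
  also have "\<dots> = exp (- \<beta> * p / 2)"
    by (simp add: powr_def field_simps flip: exp_diff)
  finally show "exp (\<alpha> * p / 2) / (1 + exp p) powr ((\<alpha> + \<beta>) / 2) \<le> exp (- \<beta> * p / 2)" .
qed

text \<open>Since |z| = e^(p/2), the power |z|^(\<alpha>-1) and the factor |z| from the derivative
  of \<open>psiC\<close> combine to e^(\<alpha>p/2), while |1 + z^2| is at least (1 + e^p) cos(pi/2
  sin y).\<close>

lemma norm_de_integrand_le:
  fixes f :: "complex \<Rightarrow> complex" and K \<alpha> \<beta> d x y :: real
  assumes d: "d \<le> pi/2" and K: "0 < K" and ab: "0 < \<alpha>" "0 < \<beta>" and y: "\<bar>y\<bar> < d"
    and hbound: "\<forall>z \<in> psiC ` strip d.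
        norm (f z) \<le> K * norm (z powr (complex_of_real (\<alpha> - 1))
              / (1 + z^2) powr (complex_of_real ((\<alpha> + \<beta>) / 2)))"
  defines "p \<equiv> pi * (sinh x * cos y)"
  shows "norm (de_integrand f (Complex x y)) \<le> K * (pi/2) / cos (pi/2 * sin y) powr ((\<alpha> + \<beta>) / 2)
           * (cosh x * (exp (\<alpha> * p / 2) / (1 + exp p) powr ((\<alpha> + \<beta>) / 2)))"
proof -
  define z s c where "z = psiC (Complex x y)" and "s = (\<alpha> + \<beta>) / 2" and "c = cos (pi/2 * sin y)"
  have y2: "\<bar>y\<bar> < pi/2" using y d by simp
  have s: "0 < s" using ab by (simp add: s_def)
  have c: "0 < c" unfolding c_def by (rule cos_half_pi_sin_pos[OF y2])
  have nz: "norm z = exp (p / 2)" by (simp add: z_def p_def norm_psiC)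
  have "(1 + exp p) * c \<le> norm (1 + z\<^sup>2)"
    unfolding z_def psiC_square p_def c_def
    using sin_mult_cosh_le'[OF y2, of x] by (intro norm_one_plus_exp_ge) (simp add: mult_ac)
  then have "((1 + exp p) * c) powr s \<le> norm (1 + z\<^sup>2) powr s"
    using c s by (intro powr_mono2) (auto intro!: mult_nonneg_nonneg add_nonneg_nonneg)
  then have den: "(1 + exp p) powr s * c powr s \<le> norm (1 + z\<^sup>2) powr s"
    using c by (subst (asm) powr_mult) (auto simp: add_nonneg_nonneg)
  have "Complex x y \<in> strip d" using y by (simp add: strip_def)
  then have "norm (f z) \<le> K * norm (z powr (complex_of_real (\<alpha> - 1)) / (1 + z^2) powr (complex_of_real s))"
    using hbound by (simp add: z_def s_def)
  also have "\<dots> = K * (norm z powr (\<alpha> - 1) / norm (1 + z\<^sup>2) powr s)"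
    by (simp only: norm_divide norm_powr_real_powr' Reals_of_real Re_complex_of_real)
  finally have f: "norm (f z) \<le> K * (norm z powr (\<alpha> - 1) / norm (1 + z\<^sup>2) powr s)" .
  have "norm (de_integrand f (Complex x y)) = norm (f z) * ((pi/2) * norm (cosh (Complex x y)) * norm z)"
    by (simp add: de_integrand_def norm_mult z_def)
  also have "\<dots> \<le> K * (norm z powr (\<alpha> - 1) / norm (1 + z\<^sup>2) powr s) * ((pi/2) * cosh x * norm z)"
    using K by (intro mult_mono f mult_right_mono mult_left_mono norm_cosh_Complex_le) auto
  also have "\<dots> = K * (pi/2) * cosh x * ((norm z powr (\<alpha> - 1) * norm z) / norm (1 + z\<^sup>2) powr s)"
    by (simp add: mult_ac)
  also have "norm z powr (\<alpha> - 1) * norm z = exp (\<alpha> * p / 2)"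
    by (simp add: nz powr_def field_simps flip: exp_add)
  also have "K * (pi/2) * cosh x * (exp (\<alpha> * p / 2) / norm (1 + z\<^sup>2) powr s)
      \<le> K * (pi/2) * cosh x * (exp (\<alpha> * p / 2) / ((1 + exp p) powr s * c powr s))"
  proof (intro mult_left_mono frac_le den)
    have "0 < 1 + exp p" by (simp add: add_pos_pos)
    then show "0 < (1 + exp p) powr s * c powr s" using c by simp
  qed (use K in auto)
  finally show ?thesis by (simp add: s_def c_def mult_ac)
qed

text \<open>Both cos y and cos(pi/2 sin y) are smallest at |y| = e, which makes the bound uniform in
  y. The rates on the two sides merge into their minimum.\<close>

lemma norm_de_integrand_strip_le:
  fixes f :: "complex \<Rightarrow> complex" and K \<alpha> \<beta> d e x y :: real
  assumes d: "d \<le> pi/2" and K: "0 < K" and ab: "0 < \<alpha>" "0 < \<beta>" and e: "e < d" and y: "\<bar>y\<bar> \<le> e"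
    and hbound: "\<forall>z \<in> psiC ` strip d.
        norm (f z) \<le> K * norm (z powr (complex_of_real (\<alpha> - 1))
              / (1 + z^2) powr (complex_of_real ((\<alpha> + \<beta>) / 2)))"
  shows "norm (de_integrand f (Complex x y)) \<le> K * (pi/2) / cos (pi/2 * sin e) powr ((\<alpha> + \<beta>) / 2)
           * (cosh x * exp (- (pi/2 * min \<alpha> \<beta> * cos e) * \<bar>sinh x\<bar>))"
proof -
  define p \<mu> where "p = pi * (sinh x * cos y)" and "\<mu> = min \<alpha> \<beta>"
  have \<mu>: "0 < \<mu>" "\<mu> \<le> \<alpha>" "\<mu> \<le> \<beta>" using ab by (auto simp: \<mu>_def)
  have e2: "0 \<le> e" "e < pi/2" using y e d by auto
  have "cos e \<le> cos \<bar>y\<bar>" using y e2 by (intro cos_monotone_0_pi_le) auto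
  then have cy: "cos e \<le> cos y" by simp
  have ce: "0 < cos e" using e2 by (intro cos_gt_zero_pi) auto
  have "exp (\<alpha> * p / 2) / (1 + exp p) powr ((\<alpha> + \<beta>) / 2) \<le> exp (- \<mu> * \<bar>p\<bar> / 2)"
  proof (cases "0 \<le> p")
    case True
    have "\<mu> * p \<le> \<beta> * p" using \<mu> True by (intro mult_right_mono)
    then have "exp (- \<beta> * p / 2) \<le> exp (- \<mu> * \<bar>p\<bar> / 2)" using True by simp
    then show ?thesis using exp_div_powr_le(2)[OF ab, of p] by linarith
  next
    case False
    have "\<alpha> * p \<le> \<mu> * p" using \<mu> False by (intro mult_right_mono_neg) auto
    then have "exp (\<alpha> * p / 2) \<le> exp (- \<mu> * \<bar>p\<bar> / 2)" using False by simp
    then show ?thesis using exp_div_powr_le(1)[OF ab, of p] by linarith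
  qed
  also have "\<dots> \<le> exp (- (pi/2 * \<mu> * cos e) * \<bar>sinh x\<bar>)"
  proof -
    have "\<bar>p\<bar> = pi * \<bar>sinh x\<bar> * cos y" using cy ce by (simp add: p_def abs_mult)
    moreover have "pi * \<bar>sinh x\<bar> * cos e \<le> pi * \<bar>sinh x\<bar> * cos y" using cy by (intro mult_left_mono) auto
    ultimately have "\<mu> * (pi * \<bar>sinh x\<bar> * cos e) \<le> \<mu> * \<bar>p\<bar>" using \<mu> by (intro mult_left_mono) auto
    then show ?thesis by (simp add: mult_ac)
  qed
  finally have 1: "exp (\<alpha> * p / 2) / (1 + exp p) powr ((\<alpha> + \<beta>) / 2) \<le> exp (- (pi/2 * \<mu> * cos e) * \<bar>sinh x\<bar>)" .
  have se: "\<bar>sin y\<bar> \<le> sin e" "0 \<le> sin e"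
  proof -
    have "sin \<bar>y\<bar> \<le> sin e" using y e2 by (intro sin_monotone_2pi_le) auto
    moreover have "0 \<le> sin \<bar>y\<bar>" using y e2 by (intro sin_ge_zero) auto
    ultimately show "\<bar>sin y\<bar> \<le> sin e" "0 \<le> sin e" by (auto simp: abs_if split: if_splits)
  qed
  have ce': "0 < cos (pi/2 * sin e)" using e2 by (intro cos_half_pi_sin_pos) auto
  have "cos (pi/2 * sin e) \<le> cos \<bar>pi/2 * sin y\<bar>"
  proof (rule cos_monotone_0_pi_le)
    show "\<bar>pi/2 * sin y\<bar> \<le> pi/2 * sin e" using se by (simp add: abs_mult)
    have "pi/2 * sin e \<le> pi/2 * 1" by (intro mult_left_mono) auto
    then show "pi/2 * sin e \<le> pi" using pi_gt_zero by linarith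
  qed auto
  then have "cos (pi/2 * sin e) \<le> cos (pi/2 * sin y)" by (simp only: cos_abs_real)
  then have 2: "cos (pi/2 * sin e) powr ((\<alpha> + \<beta>) / 2) \<le> cos (pi/2 * sin y) powr ((\<alpha> + \<beta>) / 2)"
    using ce' ab by (intro powr_mono2) auto
  have "norm (de_integrand f (Complex x y)) \<le> K * (pi/2) / cos (pi/2 * sin y) powr ((\<alpha> + \<beta>) / 2)
           * (cosh x * (exp (\<alpha> * p / 2) / (1 + exp p) powr ((\<alpha> + \<beta>) / 2)))"
    unfolding p_def using y e by (intro norm_de_integrand_le[OF d K ab _ hbound]) simp
  also have "\<dots> \<le> K * (pi/2) / cos (pi/2 * sin e) powr ((\<alpha> + \<beta>) / 2) * (cosh x * exp (- (pi/2 * \<mu> * cos e) * \<bar>sinh x\<bar>))"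
    using 1 2 K ce' by (intro mult_mono frac_le mult_left_mono) auto
  finally show ?thesis by (simp add: \<mu>_def)
qed

text \<open>On the real axis both cosines are 1. Keeping the rates \<alpha> on the left and \<beta>
  on the right apart allows M and N to be tuned separately.\<close>

lemma norm_de_integrand_real_le:
  fixes f :: "complex \<Rightarrow> complex" and K \<alpha> \<beta> d x :: real
  assumes d: "0 < d" "d \<le> pi/2" and K: "0 < K" and ab: "0 < \<alpha>" "0 < \<beta>"
    and hbound: "\<forall>z \<in> psiC ` strip d.
        norm (f z) \<le> K * norm (z powr (complex_of_real (\<alpha> - 1))
              / (1 + z^2) powr (complex_of_real ((\<alpha> + \<beta>) / 2)))"
  shows "norm (de_integrand f (of_real x)) \<le> K * (pi/2) * (cosh x * exp (- (pi * \<beta> / 2) * sinh x))"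
    and "norm (de_integrand f (of_real x)) \<le> K * (pi/2) * (cosh x * exp (pi * \<alpha> / 2 * sinh x))"
proof -
  have "norm (de_integrand f (of_real x)) \<le> K * (pi/2)
           * (cosh x * (exp (\<alpha> * (pi * sinh x) / 2) / (1 + exp (pi * sinh x)) powr ((\<alpha> + \<beta>) / 2)))" (is "_ \<le> ?B")
    using norm_de_integrand_le[OF d(2) K ab _ hbound, of 0 x] d(1) by (simp add: complex_of_real_def)
  moreover have "?B \<le> K * (pi/2) * (cosh x * exp (- \<beta> * (pi * sinh x) / 2))"
    using exp_div_powr_le(2)[OF ab] K by (intro mult_left_mono) auto
  moreover have "?B \<le> K * (pi/2) * (cosh x * exp (\<alpha> * (pi * sinh x) / 2))"
    using exp_div_powr_le(1)[OF ab] K by (intro mult_left_mono) auto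
  ultimately show "norm (de_integrand f (of_real x)) \<le> K * (pi/2) * (cosh x * exp (- (pi * \<beta> / 2) * sinh x))"
    and "norm (de_integrand f (of_real x)) \<le> K * (pi/2) * (cosh x * exp (pi * \<alpha> / 2 * sinh x))"
    by (auto simp: mult_ac)
qed

lemma de_integrand_holomorphic:
  assumes "f analytic_on (psiC ` strip d)"
  shows "de_integrand f holomorphic_on strip d"
proof -
  have hs: "(\<lambda>z::complex. sinh z) holomorphic_on A" "(\<lambda>z::complex. cosh z) holomorphic_on A" for A
    unfolding sinh_field_def cosh_field_def by (intro holomorphic_intros; simp)+
  have psi: "psiC holomorphic_on UNIV"
    unfolding psiC_def[abs_def] by (intro holomorphic_intros hs)
  then have "psiC analytic_on strip d"
    by (metis analytic_on_open analytic_on_subset open_UNIV subset_UNIV)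
  then have "f \<circ> psiC analytic_on strip d"
    using assms by (rule analytic_on_compose)
  then have "f \<circ> psiC holomorphic_on strip d"
    by (rule analytic_imp_holomorphic)
  then have "(\<lambda>z. f (psiC z)) holomorphic_on strip d"
    by (simp add: o_def)
  then show ?thesis
    unfolding de_integrand_def[abs_def]
    by (intro holomorphic_intros hs holomorphic_on_subset[OF psi]) auto
qed

section \<open>Return to the integral over (0, \<tau>)\<close>

lemma psiC_of_real: "psiC (of_real u) = of_real (psiR u)"
proof -
  have "sinh (complex_of_real u) = of_real (sinh u)"
    by (simp add: sinh_def exp_of_real scaleR_conv_of_real flip: of_real_minus of_real_diff)
  then show ?thesis by (simp only: psiC_def psiR_def exp_of_real flip: of_real_mult)
qed

lemma de_integrand_of_real: "de_integrand f (of_real u) = f (of_real (psiR u)) * of_real (psiR' u)"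
proof -
  have "cosh (complex_of_real u) = of_real (cosh u)"
    by (simp add: cosh_def exp_of_real scaleR_conv_of_real flip: of_real_minus of_real_add)
  then show ?thesis by (simp add: de_integrand_def psiC_of_real psiR'_def psiR_def)
qed

lemma psiR_psiR_inv: "0 < \<tau> \<Longrightarrow> psiR (psiR_inv \<tau>) = \<tau>"
  by (simp add: psiR_def psiR_inv_def)

lemma of_real_in_psiC_strip:
  assumes "0 < d" "0 < t"
  shows "complex_of_real t \<in> psiC ` strip d"
  using assms psiC_of_real[of "psiR_inv t"] psiR_psiR_inv[of t]
  by (intro image_eqI[of _ _ "of_real (psiR_inv t)"]) (auto simp: strip_def)

text \<open>The modulus of f is dominated by K t^(\<alpha>-1), which is integrable at 0 because
  \<alpha> > 0. The point 0 is not a value of \<open>psiC\<close>, so the estimate is made on (0,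
  \<tau>] and carried over a null set.\<close>

lemma integrable_on_from_0:
  fixes f :: "complex \<Rightarrow> complex" and K \<alpha> \<beta> d \<tau> :: real
  assumes d: "0 < d" and f: "f analytic_on (psiC ` strip d)" and K: "0 < K" and ab: "0 < \<alpha>" "0 < \<beta>"
    and hbound: "\<forall>z \<in> psiC ` strip d.
        norm (f z) \<le> K * norm (z powr (complex_of_real (\<alpha> - 1))
              / (1 + z^2) powr (complex_of_real ((\<alpha> + \<beta>) / 2)))"
    and \<tau>: "0 < \<tau>"
  shows "(\<lambda>t. f (of_real t)) integrable_on {0..\<tau>}"
proof -
  let ?S = "{0<..\<tau>}"
  have cont: "continuous_on ?S (\<lambda>t. f (of_real t))"
    using f d by (intro continuous_on_compose2[OF holomorphic_on_imp_continuous_on[OF analytic_imp_holomorphic[OF f]]]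
        continuous_intros) (auto intro: of_real_in_psiC_strip)
  have bd: "norm (f (of_real t)) \<le> K * t powr (\<alpha> - 1)" if t: "t \<in> ?S" for t
  proof -
    have "norm (f (of_real t)) \<le> K * norm (complex_of_real t powr (complex_of_real (\<alpha> - 1))
              / (1 + (complex_of_real t)^2) powr (complex_of_real ((\<alpha> + \<beta>) / 2)))"
      using hbound of_real_in_psiC_strip[OF d, of t] t by auto
    also have "\<dots> = K * (t powr (\<alpha> - 1) / norm (1 + (complex_of_real t)^2) powr ((\<alpha> + \<beta>) / 2))"
      using t by (simp only: norm_divide norm_powr_real_powr' Reals_of_real Re_complex_of_real norm_of_real) simp
    also have "norm (1 + (complex_of_real t)^2) = 1 + t\<^sup>2"
    proof -
      have "1 + (complex_of_real t)^2 = of_real (1 + t\<^sup>2)" by simp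
      then show ?thesis by (simp only: norm_of_real) (simp add: add_nonneg_nonneg)
    qed
    also have "K * (t powr (\<alpha> - 1) / (1 + t\<^sup>2) powr ((\<alpha> + \<beta>) / 2)) \<le> K * (t powr (\<alpha> - 1) / 1)"
      using K ab by (intro mult_left_mono frac_le ge_one_powr_ge_zero) auto
    finally show ?thesis by simp
  qed
  have pw: "(\<lambda>t. K * t powr (\<alpha> - 1)) integrable_on {0..\<tau>}"
    using ab \<tau> by (intro integrable_on_mult_right integrable_on_powr_from_0) auto
  have neg: "negligible ({0<..\<tau>} - {0..\<tau>} \<union> ({0..\<tau>} - {0<..\<tau>}))"
  proof -
    have "{0<..\<tau>} - {0..\<tau>} \<union> ({0..\<tau>} - {0<..\<tau>}) = {0}" using \<tau> by auto
    then show ?thesis by simp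
  qed
  have pw': "(\<lambda>t. K * t powr (\<alpha> - 1)) integrable_on ?S"
    by (rule iffD2[OF integrable_spike_set_eq[OF neg] pw])
  have "(\<lambda>t. f (of_real t)) integrable_on ?S"
  proof (rule measurable_bounded_by_integrable_imp_integrable[OF _ pw' bd])
    show "(\<lambda>t. f (of_real t)) \<in> borel_measurable (lebesgue_on ?S)"
      by (rule continuous_imp_measurable_on_sets_lebesgue[OF cont]) simp
  qed simp_all
  then show ?thesis by (rule iffD1[OF integrable_spike_set_eq[OF neg]])
qed

text \<open>Substituting t = \<open>psiR u\<close> gives the integral of f from
  \<open>psiR a\<close> to \<tau>. As a tends to minus infinity, \<open>psiR a\<close> tends to 0
  from the right, and the integral is continuous in its lower limit.\<close>

lemma tendsto_integral_de_integrand: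
  fixes f :: "complex \<Rightarrow> complex" and K \<alpha> \<beta> d \<tau> :: real
  assumes d: "0 < d" and f: "f analytic_on (psiC ` strip d)" and K: "0 < K" and ab: "0 < \<alpha>" "0 < \<beta>"
    and hbound: "\<forall>z \<in> psiC ` strip d.
        norm (f z) \<le> K * norm (z powr (complex_of_real (\<alpha> - 1))
              / (1 + z^2) powr (complex_of_real ((\<alpha> + \<beta>) / 2)))"
    and \<tau>: "0 < \<tau>"
  shows "((\<lambda>a. integral {a..psiR_inv \<tau>} (\<lambda>t. de_integrand f (of_real t)))
            \<longlongrightarrow> integral {0..\<tau>} (\<lambda>t. f (of_real t))) at_bot"
proof -
  let ?x = "psiR_inv \<tau>"
  have mono: "psiR u \<le> psiR v" if "u \<le> v" for u v using that by (simp add: psiR_def)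
  have sub: "integral {a..?x} (\<lambda>t. de_integrand f (of_real t)) = integral {psiR a..\<tau>} (\<lambda>t. f (of_real t))" if a: "a \<le> ?x" for a
  proof -
    have "((\<lambda>t. psiR' t *\<^sub>R f (of_real (psiR t))) has_integral (integral {psiR a..psiR ?x} (\<lambda>t. f (of_real t)))) {a..?x}"
    proof (rule has_integral_substitution[OF a])
      show "psiR a \<le> psiR ?x" using a by (rule mono)
      show "psiR ` {a..?x} \<subseteq> {psiR a..psiR ?x}" using mono by auto
      have "0 < psiR a" by (simp add: psiR_def)
      then show "continuous_on {psiR a..psiR ?x} (\<lambda>t. f (complex_of_real t))"
        using d by (intro continuous_on_compose2[OF holomorphic_on_imp_continuous_on[OF analytic_imp_holomorphic[OF f]]]
          continuous_intros) (auto intro!: of_real_in_psiC_strip)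
      show "(psiR has_real_derivative psiR' t) (at t within {a..?x})" for t
        unfolding psiR_def[abs_def] psiR'_def by (auto intro!: derivative_eq_intros)
    qed
    then have "((\<lambda>t. de_integrand f (of_real t)) has_integral (integral {psiR a..\<tau>} (\<lambda>t. f (of_real t)))) {a..?x}"
      using psiR_psiR_inv[OF \<tau>] by (simp add: de_integrand_of_real scaleR_conv_of_real mult.commute)
    then show ?thesis by (rule integral_unique)
  qed
  have "continuous_on {0..\<tau>} (\<lambda>s. integral {s..\<tau>} (\<lambda>t. f (of_real t)))"
    by (rule indefinite_integral_continuous_1'[OF integrable_on_from_0[OF d f K ab hbound \<tau>]])
  then have c0: "((\<lambda>s. integral {s..\<tau>} (\<lambda>t. f (of_real t))) \<longlongrightarrow> integral {0..\<tau>} (\<lambda>t. f (of_real t))) (at 0 within {0..\<tau>})"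
    using \<tau> by (simp add: continuous_on)
  have psi0: "(psiR \<longlongrightarrow> 0) at_bot"
    unfolding psiR_def[abs_def]
    by (intro filterlim_compose[OF exp_at_bot] filterlim_tendsto_pos_mult_at_bot[OF tendsto_const _ sinh_real_at_bot]) simp
  have ev: "\<forall>\<^sub>F a in at_bot. a \<le> ?x" by (rule eventually_le_at_bot)
  have "filterlim psiR (at 0 within {0..\<tau>}) at_bot"
    unfolding filterlim_at
  proof (intro conjI psi0)
    show "\<forall>\<^sub>F a in at_bot. psiR a \<in> {0..\<tau>} \<and> psiR a \<noteq> 0"
      using ev
    proof eventually_elim
      case (elim a)
      have "0 < psiR a" by (simp add: psiR_def)
      with mono[OF elim] psiR_psiR_inv[OF \<tau>] show ?case by simp
    qed
  qed
  then have "((\<lambda>a. integral {psiR a..\<tau>} (\<lambda>t. f (of_real t))) \<longlongrightarrow> integral {0..\<tau>} (\<lambda>t. f (of_real t))) at_bot"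
    by (rule filterlim_compose[OF c0])
  then show ?thesis
  proof (rule Lim_transform_eventually)
    show "\<forall>\<^sub>F a in at_bot. integral {psiR a..\<tau>} (\<lambda>t. f (of_real t)) = integral {a..?x} (\<lambda>t. de_integrand f (of_real t))"
      using ev by eventually_elim (simp add: sub)
  qed
qed

section \<open>Scalar inequalities for the cutoffs and the constant\<close>

text \<open>(pi \<gamma>/2) sinh X = (pi/4)(\<gamma> e^X - \<gamma> e^(-X)), where the first term is
  at least v and the second at most \<gamma>. Later v is 4dn.\<close>

lemma exp_sinh_cutoff_le:
  fixes \<gamma> v X :: real
  assumes g: "0 < \<gamma>" and v: "0 < v" and X: "0 \<le> X" "ln (v / \<gamma>) \<le> X"
  shows "exp (- (pi * \<gamma> / 2) * sinh X) \<le> exp (pi * \<gamma> / 4 - pi * v / 4)"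
proof -
  have "v / \<gamma> = exp (ln (v / \<gamma>))" using g v by simp
  also have "\<dots> \<le> exp X" using X by simp
  finally have "v \<le> exp X * \<gamma>" using g by (simp add: field_simps)
  moreover have "exp (- X) * \<gamma> \<le> 1 * \<gamma>" using X g by (intro mult_right_mono) auto
  ultimately have "v - \<gamma> \<le> exp X * \<gamma> - exp (- X) * \<gamma>" by linarith
  then have "pi / 4 * (v - \<gamma>) \<le> pi / 4 * (exp X * \<gamma> - exp (- X) * \<gamma>)" by (intro mult_left_mono) auto
  also have "\<dots> = pi * \<gamma> / 2 * sinh X" by (simp add: sinh_def field_simps)
  finally show ?thesis by (simp add: algebra_simps)
qed

text \<open>Later a = dn and L = log(4dn/\<mu>), and the exponential is the slack between truncation
  and discretization rates. As e^y \<ge> e y and (1 + 2/pi) sqrt 2 \<le> pi, it suffices that L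
  e^(1-L) + e (L - 1) \<ge> 1.\<close>

lemma truncation_constant_le:
  fixes a L :: real
  assumes a: "0 < a" and L: "1 \<le> L"
  shows "(1 + 2 / pi) * sqrt 2 * a \<le> L * exp (pi * a * (exp (- L) + 1 - 1 / L))"
proof -
  have pi3: "3 \<le> pi" using pi_approx by simp
  have "sqrt 2 \<le> sqrt (1.5\<^sup>2)" by (intro real_sqrt_le_mono) (simp add: power2_eq_square)
  then have "sqrt 2 \<le> 1.5" by simp
  moreover have "1 + 2 / pi \<le> 2" using pi3 by (simp add: field_simps)
  ultimately have "(1 + 2 / pi) * sqrt 2 \<le> 2 * 1.5" by (intro mult_mono) auto
  then have "(1 + 2 / pi) * sqrt 2 * a \<le> pi * a * 1" using pi3 a by simp
  also have "1 \<le> L * exp (1 - L) + exp 1 * (L - 1)"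
  proof -
    have "2 - L \<le> exp (1 - L)" using exp_ge_add_one_self[of "1 - L"] by simp
    also have "\<dots> \<le> L * exp (1 - L)" using L by simp
    finally have "2 - L \<le> L * exp (1 - L)" .
    moreover have "1 * (L - 1) \<le> exp 1 * (L - 1)" using L by (intro mult_right_mono) auto
    ultimately have "(2 - L) + 1 * (L - 1) \<le> L * exp (1 - L) + exp 1 * (L - 1)" by (rule add_mono)
    then show ?thesis by simp
  qed
  then have "pi * a * 1 \<le> pi * a * (L * exp (1 - L) + exp 1 * (L - 1))"
    using a by (intro mult_left_mono) auto
  also have "\<dots> = L * (exp 1 * (pi * a * (exp (- L) + 1 - 1 / L)))"
    using L by (simp add: field_simps exp_diff exp_minus)
  also have "\<dots> \<le> L * exp (pi * a * (exp (- L) + 1 - 1 / L))"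
  proof (intro mult_left_mono)
    let ?y = "pi * a * (exp (- L) + 1 - 1 / L)"
    have "exp 1 * ?y \<le> exp 1 * exp (?y - 1)"
      using exp_ge_add_one_self[of "?y - 1"] by (intro mult_left_mono) auto
    also have "\<dots> = exp ?y" by (simp flip: exp_add)
    finally show "exp 1 * ?y \<le> exp ?y" .
  qed (use L in simp)
  finally show ?thesis .
qed

section \<open>The error estimate\<close>

theorem theorem13:
  fixes f :: "complex \<Rightarrow> complex"
    and d K \<alpha> \<beta> :: real and n :: nat
  assumes hd: "0 < d" "d < pi/2"
    and hf: "f analytic_on (psiC ` strip d)"
    and hK: "0 < K" and ha: "0 < \<alpha>" and hb: "0 < \<beta>"
    and hbound: "\<forall>z \<in> psiC ` strip d.
        norm (f z) \<le> K * norm (z powr (complex_of_real (\<alpha> - 1))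
              / (1 + z^2) powr (complex_of_real ((\<alpha> + \<beta>) / 2)))"
    and hn: "n \<ge> 1"
    and hnbig: "real n \<ge> max \<alpha> \<beta> * exp 1 / (4 * d)"
    and hM: "real_of_int (if min \<alpha> \<beta> = \<alpha> then int n
               else int n - \<lfloor>ln (\<alpha>/\<beta>) / (ln (4*d*real n / min \<alpha> \<beta>) / real n)\<rfloor>)
             * (ln (4*d*real n / min \<alpha> \<beta>) / real n) \<ge> xgam (\<alpha>/2)"
    and hN: "real_of_int (if min \<alpha> \<beta> = \<alpha> then int n - \<lfloor>ln (\<beta>/\<alpha>) / (ln (4*d*real n / min \<alpha> \<beta>) / real n)\<rfloor>
               else int n)
             * (ln (4*d*real n / min \<alpha> \<beta>) / real n) \<ge> xgam (\<beta>/2)"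
  shows "\<forall>\<tau> > 0.
    (let \<mu> = min \<alpha> \<beta>;
         h = ln (4*d*real n / \<mu>) / real n;
         M = (if \<mu> = \<alpha> then int n else int n - \<lfloor>ln (\<alpha>/\<beta>) / h\<rfloor>);
         N = (if \<mu> = \<alpha> then int n - \<lfloor>ln (\<beta>/\<alpha>) / h\<rfloor> else int n);
         C2 = 2 * K / (\<mu> * d) *
              (1 / ((1 - exp (- pi * \<mu> * exp 1 / 2))
                    * (cos (pi/2 * sin d)) powr ((\<alpha> + \<beta>) / 2) * cos d)
               + exp (pi * (\<alpha> + \<beta>) / 4))
     in norm (integral {0..\<tau>} (\<lambda>t. f (complex_of_real t))
              - (\<Sum>k = -M..N. f (complex_of_real (psiR (real_of_int k * h)))
                   * complex_of_real (psiR' (real_of_int k * h) * Jfun k h (psiR_inv \<tau>))))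
        \<le> C2 * exp (- pi * d * real n / ln (4*d*real n / \<mu>)) * ln (4*d*real n / \<mu>) / real n)"
proof -
  define \<mu> h v where "\<mu> = min \<alpha> \<beta>" and "h = ln (4*d*real n / \<mu>) / real n" and "v = 4 * d * real n"
  define M where "M = (if \<mu> = \<alpha> then int n else int n - \<lfloor>ln (\<alpha>/\<beta>) / h\<rfloor>)"
  define N where "N = (if \<mu> = \<alpha> then int n - \<lfloor>ln (\<beta>/\<alpha>) / h\<rfloor> else int n)"
  define c where "c = cos (pi/2 * sin d) powr ((\<alpha> + \<beta>) / 2)"
  have \<mu>: "0 < \<mu>" "\<mu> \<le> \<alpha>" "\<mu> \<le> \<beta>" using ha hb by (auto simp: \<mu>_def)
  have n0: "0 < real n" using hn by simp
  have v0: "0 < v" using hd n0 by (simp add: v_def)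
  define L where "L = ln (v / \<mu>)"
  have hL: "h = L / real n" "h * real n = L" using n0 by (simp_all add: h_def L_def v_def)
  have "max \<alpha> \<beta> * exp 1 \<le> v" using hnbig hd by (simp add: v_def field_simps)
  moreover have "\<mu> * exp 1 \<le> max \<alpha> \<beta> * exp 1" using \<mu> by (intro mult_right_mono) auto
  ultimately have "\<mu> * exp 1 \<le> v" by (rule order_trans[rotated])
  \<comment> \<open>The lower bound on n enters here; it amounts to L \<ge> 1.\<close>
  then have ev: "exp 1 \<le> v / \<mu>" using \<mu>(1) by (simp add: pos_le_divide_eq mult.commute)
  then have L1: "1 \<le> L" using v0 \<mu>(1) by (simp add: L_def ln_ge_iff)
  have h0: "0 < h" using L1 n0 by (simp add: hL)
  have hM': "xgam (\<alpha>/2) \<le> M * h" using hM by (simp only: M_def h_def \<mu>_def)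
  have hN': "xgam (\<beta>/2) \<le> N * h" using hN by (simp only: N_def h_def \<mu>_def)
  have M2: "1 \<le> 2 * (pi * \<alpha> / 2) * sinh (M * h)" and M0: "0 < M * h"
    using sinh_ge_of_xgam[OF _ hM'] ha by auto
  have N2: "1 \<le> 2 * (pi * \<beta> / 2) * sinh (N * h)" and N0: "0 < N * h"
    using sinh_ge_of_xgam[OF _ hN'] hb by auto
  have MN: "0 \<le> M" "0 \<le> N" using M0 N0 h0 by (auto simp: zero_less_mult_iff)
  \<comment> \<open>Rounding down the subtracted shift can only enlarge the cutoff, so it stays at
    or above L - log(\<gamma>/\<mu>) = log(v/\<gamma>). The exponent equal to \<mu> has the cutoff
    nh = L exactly.\<close>
  have shift: "ln (v / \<gamma>) \<le> real_of_int (int n - \<lfloor>ln (\<gamma> / \<mu>) / h\<rfloor>) * h" if g: "0 < \<gamma>" for \<gamma>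
  proof -
    have "real_of_int \<lfloor>ln (\<gamma> / \<mu>) / h\<rfloor> * h \<le> ln (\<gamma> / \<mu>) / h * h"
      using h0 by (intro mult_right_mono) auto
    then have "L - ln (\<gamma> / \<mu>) \<le> real_of_int (int n - \<lfloor>ln (\<gamma> / \<mu>) / h\<rfloor>) * h"
      using h0 hL(2) by (simp add: algebra_simps)
    moreover have "L - ln (\<gamma> / \<mu>) = ln (v / \<gamma>)"
      using g v0 \<mu>(1) by (simp add: L_def ln_div)
    ultimately show ?thesis by simp
  qed
  have lnM: "ln (v / \<alpha>) \<le> M * h"
  proof (cases "\<mu> = \<alpha>")
    case True
    then show ?thesis using hL(2) by (simp add: M_def L_def mult.commute)
  next
    case False
    then have "\<mu> = \<beta>" by (auto simp: \<mu>_def min_def)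
    with False shift[OF ha] show ?thesis by (simp add: M_def)
  qed
  have lnN: "ln (v / \<beta>) \<le> N * h"
  proof (cases "\<mu> = \<alpha>")
    case True
    with shift[OF hb] show ?thesis by (simp add: N_def)
  next
    case False
    then have "\<mu> = \<beta>" by (auto simp: \<mu>_def min_def)
    with False show ?thesis using hL(2) by (simp add: N_def L_def mult.commute)
  qed
  define D where "D = pi / h * d"
  have D0: "0 < D" using h0 hd by (simp add: D_def)
  have D_eq: "D = pi * d * real n / L" using n0 L1 by (simp add: D_def hL)
  define E where "E = exp (- pi * \<mu> * exp 1 / 2)"
  have cd: "0 < cos d" using hd by (intro cos_gt_zero_pi) auto
  have c0: "0 < c" using cos_half_pi_sin_pos[of d] hd by (simp add: c_def)
  have E1: "E < 1" using \<mu>(1) by (simp add: E_def)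
  \<comment> \<open>From e L \<le> e^L = v/\<mu> it follows that 2D = (pi/2) v/L is at least (pi/2)
    \<mu> e, which explains the exponent in \<open>E\<close>.\<close>
  have ED: "exp (- 2 * D) \<le> E"
  proof -
    have "exp 1 * L \<le> v / \<mu>"
    proof -
      have "exp 1 * L \<le> exp 1 * exp (L - 1)"
        using exp_ge_add_one_self[of "L - 1"] by (intro mult_left_mono) auto
      also have "\<dots> = v / \<mu>" using v0 \<mu>(1) by (simp add: L_def flip: exp_add)
      finally show ?thesis .
    qed
    then have "\<mu> * exp 1 * L \<le> v" using \<mu>(1) by (simp add: pos_le_divide_eq mult_ac)
    then have "\<mu> * exp 1 \<le> v / L" using L1 by (simp add: pos_le_divide_eq)
    then have "pi / 2 * (\<mu> * exp 1) \<le> pi / 2 * (v / L)" by (intro mult_left_mono) auto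
    also have "\<dots> = 2 * D" by (simp add: D_eq v_def)
    finally show ?thesis by (simp add: E_def)
  qed
  let ?A = "K * (pi/2)"
  let ?C = "\<lambda>e. K * (pi/2) / cos (pi/2 * sin e) powr ((\<alpha> + \<beta>) / 2)"
  let ?b = "\<lambda>e. pi/2 * min \<alpha> \<beta> * cos e"
  let ?R = "\<lambda>e. 2 * (?C e * (2 / ?b e) / sinh (pi / h * e) * ((1 + pi) / (pi / h * e))) / (2 * pi)"
  let ?tail = "(1 + 2 / pi) * ?A * sqrt 2 * (exp (- (pi * \<beta> / 2) * sinh (N * h)) / (pi * \<beta> / 2)
      + exp (- (pi * \<alpha> / 2) * sinh (M * h)) / (pi * \<alpha> / 2))"
  \<comment> \<open>Writing sinh D = (1 - e^(-2D)) e^D / 2 produces the factor 1 - E, and the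
    remaining numerical constant 2 (1 + pi)/pi^2 is at most 1.\<close>
  have R_le: "?R d \<le> 2 * K / (\<mu> * d) * (1 / ((1 - E) * c * cos d)) * (exp (- D) * h)"
  proof -
    have sD: "(1 - E) * exp D / 2 \<le> sinh D"
    proof -
      have "sinh D = (1 - exp (- 2 * D)) * exp D / 2"
        by (simp add: sinh_def algebra_simps flip: exp_add)
      moreover have "(1 - E) * exp D / 2 \<le> (1 - exp (- 2 * D)) * exp D / 2"
        using ED by (intro divide_right_mono mult_right_mono) auto
      ultimately show ?thesis by simp
    qed
    have sD0: "0 < (1 - E) * exp D / 2" using E1 by simp
    have p2: "2 * (1 + pi) / pi\<^sup>2 \<le> 1"
    proof -
      have "2 * (1 + pi) \<le> 3 * pi" using pi_approx by simp
      also have "\<dots> \<le> pi * pi" using pi_approx by (intro mult_right_mono) auto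
      finally show ?thesis by (simp add: power2_eq_square divide_le_eq)
    qed
    have "?R d = 2 * K * h / (\<mu> * d * c * cos d) * ((1 + pi) / pi\<^sup>2) / sinh D"
    proof -
      \<comment> \<open>Variables stand in for \<open>pi\<close>, \<open>cos d\<close> and
        \<open>sinh D\<close>, so that the identity is one of rational functions.\<close>
      have "2 * (K * (p/2) / c * (2 / (p/2 * \<mu> * x)) / S * ((1 + p) / (p / h * d))) / (2 * p)
          = 2 * K * h / (\<mu> * d * c * x) * ((1 + p) / p\<^sup>2) / S" if "p \<noteq> 0" "x \<noteq> 0" "S \<noteq> 0" for p x S :: real
        using that hd(1) h0 c0 \<mu>(1) by (simp add: field_simps power2_eq_square)
      moreover have "cos d \<noteq> 0" "sinh D \<noteq> 0" using cd D0 by simp_all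
      ultimately have "2 * (K * (pi/2) / c * (2 / (pi/2 * \<mu> * cos d)) / sinh D * ((1 + pi) / (pi / h * d))) / (2 * pi)
          = 2 * K * h / (\<mu> * d * c * cos d) * ((1 + pi) / pi\<^sup>2) / sinh D"
        using pi_neq_zero by blast
      then show ?thesis by (simp only: D_def c_def \<mu>_def)
    qed
    also have "\<dots> \<le> 2 * K * h / (\<mu> * d * c * cos d) * ((1 + pi) / pi\<^sup>2) / ((1 - E) * exp D / 2)"
      using sD sD0 D0 hK h0 hd c0 cd \<mu>(1) by (intro divide_left_mono mult_pos_pos) auto
    also have "\<dots> = 2 * K * h / (\<mu> * d * c * cos d * (1 - E) * exp D) * (2 * (1 + pi) / pi\<^sup>2)"
      by (simp add: field_simps)
    also have "\<dots> \<le> 2 * K * h / (\<mu> * d * c * cos d * (1 - E) * exp D) * 1"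
      using p2 hK h0 hd c0 cd \<mu>(1) E1 by (intro mult_left_mono) auto
    also have "\<dots> = 2 * K / (\<mu> * d) * (1 / ((1 - E) * c * cos d)) * (exp (- D) * h)"
      by (simp add: exp_minus field_simps)
    finally show ?thesis .
  qed
  \<comment> \<open>Both cutoffs leave at most exp(pi \<nu>/4 - pi v/4), with \<nu> the larger
    exponent. The slack between this and e^(-D) absorbs the factor (1 + 2/pi) sqrt 2.\<close>
  have tail_le: "?tail \<le> 2 * K / (\<mu> * d) * exp (pi * (\<alpha> + \<beta>) / 4) * (exp (- D) * h)"
  proof -
    define \<nu> where "\<nu> = max \<alpha> \<beta>"
    have mn: "\<alpha> + \<beta> = \<mu> + \<nu>" by (simp add: \<mu>_def \<nu>_def)
    have one: "exp (- (pi * \<gamma> / 2) * sinh X) / (pi * \<gamma> / 2) \<le> exp (pi * \<nu> / 4 - pi * v / 4) / (pi * \<mu> / 2)"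
      if g: "0 < \<gamma>" "\<mu> \<le> \<gamma>" "\<gamma> \<le> \<nu>" and X: "0 < X" "ln (v / \<gamma>) \<le> X" for \<gamma> X
    proof (rule frac_le)
      have "exp (- (pi * \<gamma> / 2) * sinh X) \<le> exp (pi * \<gamma> / 4 - pi * v / 4)"
        using g v0 X by (intro exp_sinh_cutoff_le) auto
      also have "\<dots> \<le> exp (pi * \<nu> / 4 - pi * v / 4)" using g by simp
      finally show "exp (- (pi * \<gamma> / 2) * sinh X) \<le> exp (pi * \<nu> / 4 - pi * v / 4)" .
    qed (use g \<mu> in auto)
    have s: "exp (- (pi * \<beta> / 2) * sinh (N * h)) / (pi * \<beta> / 2) + exp (- (pi * \<alpha> / 2) * sinh (M * h)) / (pi * \<alpha> / 2)
        \<le> 2 * (exp (pi * \<nu> / 4 - pi * v / 4) / (pi * \<mu> / 2))"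
      using one[OF hb _ _ N0 lnN] one[OF ha _ _ M0 lnM] \<mu> by (simp add: \<nu>_def)
    have "?tail \<le> (1 + 2 / pi) * ?A * sqrt 2 * (2 * (exp (pi * \<nu> / 4 - pi * v / 4) / (pi * \<mu> / 2)))"
      using hK by (intro mult_left_mono s) auto
    also have "\<dots> = 2 * K / \<mu> * (exp (pi * \<nu> / 4 - pi * v / 4)) * ((1 + 2 / pi) * sqrt 2)"
    proof -
      have "y * (K * (p/2)) * s * (2 * (X / (p * \<mu> / 2))) = 2 * K / \<mu> * X * (y * s)" if "p \<noteq> 0" for p s X y :: real
        using that \<mu>(1) by (simp add: field_simps)
      then show ?thesis using pi_neq_zero by blast
    qed
    also have "\<dots> \<le> 2 * K / \<mu> * (exp (pi * \<nu> / 4 - pi * v / 4)) * (h / d * exp (pi * \<mu> / 4 + pi * v / 4 - D))"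
    proof (rule mult_left_mono)
      have "exp (- L) = \<mu> / v" using v0 \<mu>(1) by (simp add: L_def exp_minus)
      \<comment> \<open>The product pi d n is pi v/4; multiplied by e^(-L) = \<mu>/v it becomes pi
        \<mu>/4, and divided by L it is D.\<close>
      then have eq: "pi * (d * real n) * (exp (- L) + 1 - 1 / L) = pi * \<mu> / 4 + pi * v / 4 - D"
        using hd n0 L1 by (simp add: v_def D_eq field_simps)
      have "(1 + 2 / pi) * sqrt 2 * (d * real n) \<le> L * exp (pi * \<mu> / 4 + pi * v / 4 - D)"
        using truncation_constant_le[of "d * real n" L] hd n0 L1 by (simp only: eq) simp
      then have "(1 + 2 / pi) * sqrt 2 \<le> L * exp (pi * \<mu> / 4 + pi * v / 4 - D) / (d * real n)"
        using hd n0 by (simp only: pos_le_divide_eq mult_pos_pos)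
      also have "\<dots> = h / d * exp (pi * \<mu> / 4 + pi * v / 4 - D)"
        by (simp add: hL(1))
      finally show "(1 + 2 / pi) * sqrt 2 \<le> h / d * exp (pi * \<mu> / 4 + pi * v / 4 - D)" .
    qed (use hK \<mu> in auto)
    also have "\<dots> = 2 * K / (\<mu> * d) * (exp (pi * \<nu> / 4 - pi * v / 4) * exp (pi * \<mu> / 4 + pi * v / 4 - D)) * h"
      by simp
    also have "exp (pi * \<nu> / 4 - pi * v / 4) * exp (pi * \<mu> / 4 + pi * v / 4 - D) = exp (pi * (\<alpha> + \<beta>) / 4) * exp (- D)"
      unfolding mn by (simp add: algebra_simps add_divide_distrib flip: exp_add)
    finally show ?thesis by (simp add: mult_ac)
  qed
  have main: "norm (integral {0..\<tau>} (\<lambda>t. f (complex_of_real t))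
              - (\<Sum>k\<in>{-M..N}. de_integrand f (of_real (k * h)) * of_real (Jfun k h (psiR_inv \<tau>)))) \<le> ?R d + ?tail"
    (is "?err \<le> _") if \<tau>: "0 < \<tau>" for \<tau>
  \<comment> \<open>The contour must stay inside the strip, so the estimate holds for e < d. The
    error does not depend on e, hence the bound passes to the limit as e tends to d from the
    left.\<close>
  proof (rule tendsto_lowerbound)
    show "((\<lambda>e. ?R e + ?tail) \<longlongrightarrow> ?R d + ?tail) (at_left d)"
      using hd h0 c0 cd \<mu>(1) D0 cos_half_pi_sin_pos[of d]
      by (intro tendsto_intros) (auto simp: D_def \<mu>_def)
    have "\<forall>\<^sub>F e in at_left d. e \<in> {0<..<d}" using hd by (intro eventually_at_left_real)
    then show "\<forall>\<^sub>F e in at_left d. ?err \<le> ?R e + ?tail"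
    proof eventually_elim
      case (elim e)
      have ce: "0 < cos e" using elim hd by (intro cos_gt_zero_pi) auto
      show ?case
      proof (rule sinc_indefinite_error[where F = "de_integrand f", OF h0 de_integrand_holomorphic[OF hf]])
        show "0 < ?b e" using ce \<mu>(1) by (simp add: \<mu>_def)
        show "0 \<le> ?C e" using hK by simp
        show "norm (de_integrand f (Complex u y)) \<le> ?C e * (cosh u * exp (- ?b e * \<bar>sinh u\<bar>))" if "\<bar>y\<bar> \<le> e" for u y
          using elim hd that by (intro norm_de_integrand_strip_le[OF _ hK ha hb _ _ hbound]) auto
        show "norm (de_integrand f (of_real u)) \<le> ?A * (cosh u * exp (- (pi * \<beta> / 2) * sinh u))" for u
          using hd by (intro norm_de_integrand_real_le[OF _ _ hK ha hb hbound]) auto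
        show "norm (de_integrand f (of_real u)) \<le> ?A * (cosh u * exp (pi * \<alpha> / 2 * sinh u))" for u
          using hd by (intro norm_de_integrand_real_le[OF _ _ hK ha hb hbound]) auto
        show "((\<lambda>a. integral {a..psiR_inv \<tau>} (\<lambda>t. de_integrand f (of_real t)))
            \<longlongrightarrow> integral {0..\<tau>} (\<lambda>t. f (of_real t))) at_bot"
          by (rule tendsto_integral_de_integrand[OF hd(1) hf hK ha hb hbound \<tau>])
      qed (use elim hK ha hb MN M2 N2 in auto)
    qed
  qed simp
  have "norm (integral {0..\<tau>} (\<lambda>t. f (complex_of_real t))
              - (\<Sum>k = -M..N. f (complex_of_real (psiR (real_of_int k * h)))
                   * complex_of_real (psiR' (real_of_int k * h) * Jfun k h (psiR_inv \<tau>))))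
        \<le> 2 * K / (\<mu> * d) * (1 / ((1 - E) * c * cos d) + exp (pi * (\<alpha> + \<beta>) / 4))
            * exp (- pi * d * real n / ln (4*d*real n / \<mu>)) * ln (4*d*real n / \<mu>) / real n" if \<tau>: "0 < \<tau>" for \<tau>
  proof -
    have "norm (integral {0..\<tau>} (\<lambda>t. f (complex_of_real t))
              - (\<Sum>k = -M..N. f (complex_of_real (psiR (real_of_int k * h)))
                   * complex_of_real (psiR' (real_of_int k * h) * Jfun k h (psiR_inv \<tau>)))) \<le> ?R d + ?tail"
    proof -
      have "(\<Sum>k = -M..N. f (complex_of_real (psiR (real_of_int k * h)))
                   * complex_of_real (psiR' (real_of_int k * h) * Jfun k h (psiR_inv \<tau>)))
          = (\<Sum>k\<in>{-M..N}. de_integrand f (of_real (k * h)) * of_real (Jfun k h (psiR_inv \<tau>)))"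
        by (rule sum.cong[OF refl], subst de_integrand_of_real) (simp add: mult.assoc)
      then show ?thesis using main[OF \<tau>] by (simp only:)
    qed
    also have "\<dots> \<le> 2 * K / (\<mu> * d) * (1 / ((1 - E) * c * cos d)) * (exp (- D) * h)
        + 2 * K / (\<mu> * d) * exp (pi * (\<alpha> + \<beta>) / 4) * (exp (- D) * h)"
      by (rule add_mono[OF R_le tail_le])
    also have "\<dots> = 2 * K / (\<mu> * d) * (1 / ((1 - E) * c * cos d) + exp (pi * (\<alpha> + \<beta>) / 4)) * exp (- D) * h"
      by (simp only: distrib_left distrib_right mult.assoc)
    also have "\<dots> = 2 * K / (\<mu> * d) * (1 / ((1 - E) * c * cos d) + exp (pi * (\<alpha> + \<beta>) / 4))
            * exp (- pi * d * real n / ln (4*d*real n / \<mu>)) * ln (4*d*real n / \<mu>) / real n"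
    proof -
      have "- D = - pi * d * real n / ln (4*d*real n / \<mu>)"
        by (simp add: D_eq L_def v_def)
      then show ?thesis by (simp only: h_def times_divide_eq_right)
    qed
    finally show ?thesis .
  qed
  then show ?thesis
    unfolding Let_def E_def c_def M_def N_def h_def \<mu>_def by blast
qed

end
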